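(* Let $T$ be a Sarason-Toeplitz operator on $H^2$. There exists a symbol $\phi\in N^+$ for which $T=M_\phi$ (as operators, including equality of domains) if and only if $\langle T(zf),1\rangle=0$ for all $f\in D(T)$. Moreover, in this case the Sarason Sub-Symbol of $T$ is unique, i.e. $R_{f_1}=R_{f_2}$ for all $f_1,f_2\in D(T)\setminus\{0\}$.
   Context: $H^2=H^2(\mathbb{T})$ is the Hardy space (subspace of $L^2(\mathbb{T})$ spanned by $\{e^{in\theta}\}_{n\ge0}$, equivalently analytic functions on the unit disc with square-summable Taylor coefficients); $S=M_z$ is the shift. A Sarason-Toeplitz operator is a closed, densely defined operator $T$ on $H^2$ with domain $D(T)$ such that: (1) $zf\in D(T)$ whenever $f\in D(T)$; (2) $S^*T(zf)=Tf$ for all $f\in D(T)$; (3) if $f\in D(T)$ and $f(0)=0$ then $S^*f\in D(T)$. $N^+$ denotes the Smirnov class (functions on the disc of the form $b/a$ with $a,b\in H^\infty$, $a$ outer). For an analytic function $\phi$, $M_\phi$ is the operator $f\mapsto\phi f$ on $D(M_\phi)=\{f\in H^2:\phi f\in H^2\}$. For $f\in D(T)\setminus\{0\}$, the Sarason Sub-Symbol is $R_f=h_f/f$ with $h_f=\sum_{n=1}^\infty \langle T(z^nf),1\rangle e^{-in\theta}+\sum_{n=0}^\infty\langle Tf,z^n\rangle e^{in\theta}$. *)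

theory Defs
  imports "HOL-Analysis.Analysis"
begin

abbreviation disc :: "complex set" where "disc \<equiv> ball 0 1"

text \<open>Elements of H^2 are represented as functions on the disc, extended by 0 outside.
  The n-th Taylor coefficient at 0 equals the inner product with z^n.\<close>
definition coef :: "(complex \<Rightarrow> complex) \<Rightarrow> nat \<Rightarrow> complex" where
  "coef f n = (deriv ^^ n) f 0 / of_nat (fact n)"

definition H2 :: "(complex \<Rightarrow> complex) set" where
  "H2 = {f. f holomorphic_on disc \<and> (\<forall>z. z \<notin> disc \<longrightarrow> f z = 0)
            \<and> summable (\<lambda>n. (norm (coef f n))\<^sup>2)}"

definition h2_norm :: "(complex \<Rightarrow> complex) \<Rightarrow> real" where
  "h2_norm f = sqrt (\<Sum>n. (norm (coef f n))\<^sup>2)"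

definition shift :: "(complex \<Rightarrow> complex) \<Rightarrow> complex \<Rightarrow> complex" where
  "shift f = (\<lambda>z. if z \<in> disc then z * f z else 0)"

definition bshift :: "(complex \<Rightarrow> complex) \<Rightarrow> complex \<Rightarrow> complex" where
  "bshift f = (\<lambda>z. if z \<in> disc then (if z = 0 then deriv f 0 else (f z - f 0) / z) else 0)"

definition linear_op :: "(complex \<Rightarrow> complex) set \<Rightarrow> ((complex \<Rightarrow> complex) \<Rightarrow> (complex \<Rightarrow> complex)) \<Rightarrow> bool" where
  "linear_op D T \<longleftrightarrow> D \<subseteq> H2 \<and> (\<forall>f\<in>D. T f \<in> H2) \<and> (\<lambda>z. 0) \<in> D \<and>
     (\<forall>f\<in>D. \<forall>g\<in>D. \<forall>a b::complex. (\<lambda>z. a * f z + b * g z) \<in> D \<and>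
        T (\<lambda>z. a * f z + b * g z) = (\<lambda>z. a * T f z + b * T g z))"

definition closed_op :: "(complex \<Rightarrow> complex) set \<Rightarrow> ((complex \<Rightarrow> complex) \<Rightarrow> (complex \<Rightarrow> complex)) \<Rightarrow> bool" where
  "closed_op D T \<longleftrightarrow> (\<forall>(F :: nat \<Rightarrow> complex \<Rightarrow> complex) f g.
      (\<forall>k. F k \<in> D) \<longrightarrow> f \<in> H2 \<longrightarrow> g \<in> H2 \<longrightarrow>
      (\<lambda>k. h2_norm (\<lambda>z. F k z - f z)) \<longlonglongrightarrow> 0 \<longrightarrow>
      (\<lambda>k. h2_norm (\<lambda>z. T (F k) z - g z)) \<longlonglongrightarrow> 0 \<longrightarrow>
      f \<in> D \<and> T f = g)"

definition densely_defined :: "(complex \<Rightarrow> complex) set \<Rightarrow> bool" where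
  "densely_defined D \<longleftrightarrow> (\<forall>f\<in>H2. \<forall>e>0. \<exists>g\<in>D. h2_norm (\<lambda>z. f z - g z) < e)"

definition sarason_toeplitz :: "(complex \<Rightarrow> complex) set \<Rightarrow> ((complex \<Rightarrow> complex) \<Rightarrow> (complex \<Rightarrow> complex)) \<Rightarrow> bool" where
  "sarason_toeplitz D T \<longleftrightarrow> linear_op D T \<and> closed_op D T \<and> densely_defined D \<and>
     (\<forall>f\<in>D. shift f \<in> D) \<and>
     (\<forall>f\<in>D. bshift (T (shift f)) = T f) \<and>
     (\<forall>f\<in>D. f 0 = 0 \<longrightarrow> bshift f \<in> D)"

definition Hinf :: "(complex \<Rightarrow> complex) set" where
  "Hinf = {f. f holomorphic_on disc \<and> bounded (f ` disc)}"

definition outer :: "(complex \<Rightarrow> complex) \<Rightarrow> bool" where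
  "outer a \<longleftrightarrow> (\<exists>(c::complex) (u::real \<Rightarrow> real). norm c = 1 \<and>
      set_integrable lborel {0..2*pi} u \<and>
      (\<forall>z\<in>disc. a z = c * exp ((1 / (2 * pi)) *
         (LINT t:{0..2*pi}|lborel. ((exp (\<i> * t) + z) / (exp (\<i> * t) - z)) * complex_of_real (u t)))))"

definition smirnov :: "(complex \<Rightarrow> complex) set" where
  "smirnov = {\<phi>. \<exists>a b. a \<in> Hinf \<and> b \<in> Hinf \<and> outer a \<and> (\<forall>z\<in>disc. \<phi> z = b z / a z)}"

definition mult_op :: "(complex \<Rightarrow> complex) \<Rightarrow> (complex \<Rightarrow> complex) \<Rightarrow> complex \<Rightarrow> complex" where
  "mult_op \<phi> f = (\<lambda>z. if z \<in> disc then \<phi> z * f z else 0)"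

definition mult_dom :: "(complex \<Rightarrow> complex) \<Rightarrow> (complex \<Rightarrow> complex) set" where
  "mult_dom \<phi> = {f \<in> H2. mult_op \<phi> f \<in> H2}"

text \<open>Sarason sub-symbol. The Fourier coefficients of h_f (indexed by int); h_f is
  evaluated on the disc through its harmonic (Poisson) extension, e^{in theta} \<mapsto> z^n,
  e^{-in theta} \<mapsto> (cnj z)^n, and R_f = h_f / f.\<close>
definition hf_coeff :: "((complex \<Rightarrow> complex) \<Rightarrow> (complex \<Rightarrow> complex)) \<Rightarrow> (complex \<Rightarrow> complex) \<Rightarrow> int \<Rightarrow> complex" where
  "hf_coeff T f k = (if k \<ge> 0 then coef (T f) (nat k) else T ((shift ^^ nat (- k)) f) 0)"

definition hf :: "((complex \<Rightarrow> complex) \<Rightarrow> (complex \<Rightarrow> complex)) \<Rightarrow> (complex \<Rightarrow> complex) \<Rightarrow> complex \<Rightarrow> complex" where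
  "hf T f z = (\<Sum>n. hf_coeff T f (- int (Suc n)) * (cnj z) ^ Suc n) + (\<Sum>n. hf_coeff T f (int n) * z ^ n)"

definition sub_symbol :: "((complex \<Rightarrow> complex) \<Rightarrow> (complex \<Rightarrow> complex)) \<Rightarrow> (complex \<Rightarrow> complex) \<Rightarrow> complex \<Rightarrow> complex" where
  "sub_symbol T f z = hf T f z / f z"

text \<open>Equality of sub-symbols as functions on the disc (away from the isolated zeros of f1, f2).\<close>
definition same_sub_symbol :: "((complex \<Rightarrow> complex) \<Rightarrow> (complex \<Rightarrow> complex)) \<Rightarrow> (complex \<Rightarrow> complex) \<Rightarrow> (complex \<Rightarrow> complex) \<Rightarrow> bool" where
  "same_sub_symbol T f1 f2 \<longleftrightarrow> (\<forall>z\<in>disc. f1 z \<noteq> 0 \<longrightarrow> f2 z \<noteq> 0 \<longrightarrow> sub_symbol T f1 z = sub_symbol T f2 z)"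

end

theory Submission
  imports Defs
    "HOL-Complex_Analysis.Complex_Analysis"
    "HOL-Computational_Algebra.Fundamental_Theorem_Algebra"
    "HOL-Real_Asymp.Real_Asymp"
begin

text \<open>
  If \<open>T (z f)\<close> always vanishes at the origin, then \<open>T\<close> commutes with multiplication by \<open>z\<close>, so its
  graph \<open>G\<close> is a closed shift-invariant subspace of \<open>H\<^sup>2 \<times> H\<^sup>2\<close>, and an element of \<open>G\<close> whose first
  component vanishes at the origin is \<open>z\<close> times an element of \<open>G\<close>. Hence \<open>G\<close> modulo \<open>z G\<close> is
  one-dimensional; if \<open>(a, b)\<close> is a unit vector of \<open>G\<close> orthogonal to \<open>z G\<close>, then the Wold decomposition gives
  \<open>G = {(a h, b h) | h \<in> H\<^sup>2}\<close> with \<open>h \<mapsto> (a h, b h)\<close> isometric. Isometry bounds \<open>a\<close> and \<open>b\<close> by 1.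

  The domain \<open>a H\<^sup>2\<close> is dense, which makes \<open>a\<close> outer: along some sequence of radii \<open>- log \<bar>a\<bar>\<close>
  converges almost everywhere on the circle to a function \<open>V\<close>. Fatou's lemma bounds the mean of \<open>V\<close> from
  above by \<open>- log \<bar>a 0\<bar>\<close>; Szego's inequality, applied to polynomials \<open>p\<close> with \<open>a p\<close> close to 1, bounds
  it from below by the same number. By Scheffe's lemma the convergence holds in \<open>L\<^sup>1\<close>, and the Schwarz
  integral formula for \<open>log a\<close> on smaller circles passes to the limit.

  The graph of multiplication by \<open>b / a\<close> has the same structure and contains \<open>G\<close>; comparing
  generators shows that the two graphs coincide.
\<close>

section \<open>Square-summable sequences\<close>

typedef ell2 = "{x :: nat \<Rightarrow> complex. summable (\<lambda>n. (norm (x n))\<^sup>2)}"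
  morphisms nth_ell2 Abs_ell2
  by (rule exI[of _ "\<lambda>_. 0"]) simp

setup_lifting type_definition_ell2

lemma summable_nth_sq: "summable (\<lambda>n. (norm (nth_ell2 x n))\<^sup>2)"
  using nth_ell2[of x] by simp

lemma ell2_eqI: "(\<And>n. nth_ell2 x n = nth_ell2 y n) \<Longrightarrow> x = y"
  by (metis ext nth_ell2_inject)

lemma square_summable_add:
  fixes x y :: "nat \<Rightarrow> complex"
  assumes "summable (\<lambda>n. (norm (x n))\<^sup>2)" "summable (\<lambda>n. (norm (y n))\<^sup>2)"
  shows "summable (\<lambda>n. (norm (x n + y n))\<^sup>2)"
proof (rule summable_comparison_test')
  show "summable (\<lambda>n. 2 * (norm (x n))\<^sup>2 + 2 * (norm (y n))\<^sup>2)"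
    using assms by (intro summable_add summable_mult)
  fix n
  have "(norm (x n + y n))\<^sup>2 \<le> (norm (x n) + norm (y n))\<^sup>2"
    by (intro power_mono norm_triangle_ineq) auto
  also have "\<dots> \<le> 2 * (norm (x n))\<^sup>2 + 2 * (norm (y n))\<^sup>2"
    using sum_squares_bound[of "norm (x n)" "norm (y n)"] by (simp add: power2_sum)
  finally show "norm ((norm (x n + y n))\<^sup>2) \<le> 2 * (norm (x n))\<^sup>2 + 2 * (norm (y n))\<^sup>2" by simp
qed

lemma square_summable_inner:
  fixes x y :: "nat \<Rightarrow> complex"
  assumes "summable (\<lambda>n. (norm (x n))\<^sup>2)" "summable (\<lambda>n. (norm (y n))\<^sup>2)"
  shows "summable (\<lambda>n. inner (x n) (y n))"
proof (rule summable_comparison_test')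
  show "summable (\<lambda>n. (norm (x n))\<^sup>2 + (norm (y n))\<^sup>2)"
    using assms by (intro summable_add)
  fix n
  have "norm (inner (x n) (y n)) \<le> norm (x n) * norm (y n)"
    using Cauchy_Schwarz_ineq2 by simp
  also have "\<dots> \<le> (norm (x n))\<^sup>2 + (norm (y n))\<^sup>2"
    using sum_squares_bound[of "norm (x n)" "norm (y n)"]
      mult_nonneg_nonneg[OF norm_ge_zero[of "x n"] norm_ge_zero[of "y n"]] by linarith
  finally show "norm (inner (x n) (y n)) \<le> (norm (x n))\<^sup>2 + (norm (y n))\<^sup>2" .
qed

lemma square_summable_mult:
  fixes x :: "nat \<Rightarrow> complex"
  assumes "summable (\<lambda>n. (norm (x n))\<^sup>2)"
  shows "summable (\<lambda>n. (norm (c * x n))\<^sup>2)"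
  using summable_mult[OF assms, of "(norm c)\<^sup>2"] by (simp add: norm_mult power_mult_distrib)

text \<open>The type class asks for a real inner product, so this is the real part of the Hermitian
  one; the norm is the same. Orthogonality over the complex numbers is recovered in
  \<open>pythagoras\<close>.\<close>

instantiation ell2 :: real_inner
begin

lift_definition zero_ell2 :: ell2 is "\<lambda>_. 0" by simp
lift_definition plus_ell2 :: "ell2 \<Rightarrow> ell2 \<Rightarrow> ell2" is "\<lambda>x y n. x n + y n"
  by (rule square_summable_add)
lift_definition uminus_ell2 :: "ell2 \<Rightarrow> ell2" is "\<lambda>x n. - x n" by simp
lift_definition minus_ell2 :: "ell2 \<Rightarrow> ell2 \<Rightarrow> ell2" is "\<lambda>x y n. x n - y n"
  subgoal for x y using square_summable_add[of x "\<lambda>n. - y n"] by simp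
  done
lift_definition scaleR_ell2 :: "real \<Rightarrow> ell2 \<Rightarrow> ell2" is "\<lambda>r x n. r *\<^sub>R x n"
  unfolding scaleR_conv_of_real by (rule square_summable_mult)
lift_definition inner_ell2 :: "ell2 \<Rightarrow> ell2 \<Rightarrow> real" is "\<lambda>x y. \<Sum>n. inner (x n) (y n)" .
definition norm_ell2 :: "ell2 \<Rightarrow> real" where "norm_ell2 x = sqrt (inner x x)"
definition sgn_ell2 :: "ell2 \<Rightarrow> ell2" where "sgn_ell2 x = scaleR (inverse (norm x)) x"
definition dist_ell2 :: "ell2 \<Rightarrow> ell2 \<Rightarrow> real" where "dist_ell2 x y = norm (x - y)"
definition uniformity_ell2 :: "(ell2 \<times> ell2) filter" where
  "uniformity_ell2 = (INF e\<in>{0<..}. principal {(x, y). dist x y < e})"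
definition open_ell2 :: "ell2 set \<Rightarrow> bool" where
  "open_ell2 U \<longleftrightarrow> (\<forall>x\<in>U. eventually (\<lambda>(x', y). x' = x \<longrightarrow> y \<in> U) uniformity)"

instance
proof
  fix x y z :: ell2 and r s :: real
  show "x + y + z = x + (y + z)" by transfer (simp add: algebra_simps)
  show "x + y = y + x" by transfer (simp add: algebra_simps)
  show "0 + x = x" by transfer simp
  show "- x + x = 0" by transfer simp
  show "x - y = x + - y" by transfer simp
  show "r *\<^sub>R (x + y) = r *\<^sub>R x + r *\<^sub>R y" by transfer (simp add: scaleR_add_right)
  show "(r + s) *\<^sub>R x = r *\<^sub>R x + s *\<^sub>R x" by transfer (simp add: scaleR_add_left)
  show "r *\<^sub>R s *\<^sub>R x = (r * s) *\<^sub>R x" by transfer simp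
  show "1 *\<^sub>R x = x" by transfer simp
  show "sgn x = scaleR (inverse (norm x)) x" by (rule sgn_ell2_def)
  show "dist x y = norm (x - y)" by (rule dist_ell2_def)
  show "uniformity = (INF e\<in>{0<..}. principal {(x::ell2, y). dist x y < e})"
    by (rule uniformity_ell2_def)
  show "open U = (\<forall>x\<in>U. eventually (\<lambda>(x', y). x' = x \<longrightarrow> y \<in> U) uniformity)" for U :: "ell2 set"
    by (rule open_ell2_def)
  show "inner x y = inner y x" by transfer (simp add: inner_commute)
  show "inner (x + y) z = inner x z + inner y z"
    by transfer (simp add: inner_add_left suminf_add square_summable_inner)
  show "inner (r *\<^sub>R x) y = r * inner x y"
    by transfer (simp add: suminf_mult square_summable_inner)
  show "0 \<le> inner x x"
    by transfer (intro suminf_nonneg square_summable_inner inner_ge_zero)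
  show "inner x x = 0 \<longleftrightarrow> x = 0"
    by transfer (subst suminf_eq_zero_iff; simp add: square_summable_inner fun_eq_iff)
  show "norm x = sqrt (inner x x)" by (rule norm_ell2_def)
qed

end

lemma nth_ell2_simps [simp]:
  "nth_ell2 0 n = 0" "nth_ell2 (x + y) n = nth_ell2 x n + nth_ell2 y n"
  "nth_ell2 (x - y) n = nth_ell2 x n - nth_ell2 y n" "nth_ell2 (- x) n = - nth_ell2 x n"
  "nth_ell2 (r *\<^sub>R x) n = r *\<^sub>R nth_ell2 x n"
  by (simp_all add: zero_ell2.rep_eq plus_ell2.rep_eq minus_ell2.rep_eq uminus_ell2.rep_eq scaleR_ell2.rep_eq)

lemma inner_ell2_eq: "inner x y = (\<Sum>n. inner (nth_ell2 x n) (nth_ell2 y n))"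
  by (rule inner_ell2.rep_eq)

lemma norm_ell2_sq: "(norm x)\<^sup>2 = (\<Sum>n. (norm (nth_ell2 x n))\<^sup>2)"
  unfolding power2_norm_eq_inner inner_ell2_eq ..

lemma norm_nth_le: "norm (nth_ell2 x n) \<le> norm x"
proof -
  have "(norm (nth_ell2 x n))\<^sup>2 \<le> (norm x)\<^sup>2"
    unfolding norm_ell2_sq using sum_le_suminf[OF summable_nth_sq, of "{n}" x] by simp
  then show ?thesis by (rule power2_le_imp_le) simp
qed

lemma bounded_linear_nth: "bounded_linear (\<lambda>x. nth_ell2 x n)"
  by (rule bounded_linear_intro[of _ 1]) (auto intro: norm_nth_le)

instance ell2 :: complete_space
proof
  fix X :: "nat \<Rightarrow> ell2"
  assume X: "Cauchy X"
  have "Cauchy (\<lambda>k. nth_ell2 (X k) n)" for n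
    using bounded_linear.Cauchy[OF bounded_linear_nth X] .
  then have "\<exists>l. (\<lambda>k. nth_ell2 (X k) n) \<longlonglongrightarrow> l" for n
    by (simp add: Cauchy_convergent_iff convergent_def)
  then have "\<exists>l. \<forall>n. (\<lambda>k. nth_ell2 (X k) n) \<longlonglongrightarrow> l n"
    by (intro choice allI)
  then obtain l where l: "\<And>n. (\<lambda>k. nth_ell2 (X k) n) \<longlonglongrightarrow> l n" by blast
  \<comment> \<open>Fatou's lemma for series: bounds of the finite sections pass to the coordinatewise limit.\<close>
  have part: "(\<Sum>n<N. (norm (nth_ell2 (X j) n - l n))\<^sup>2) \<le> e\<^sup>2"
    if "\<And>k. k \<ge> M \<Longrightarrow> norm (X j - X k) \<le> e" for j M N e
  proof (rule tendsto_upperbound)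
    show "(\<lambda>k. \<Sum>n<N. (norm (nth_ell2 (X j) n - nth_ell2 (X k) n))\<^sup>2)
        \<longlonglongrightarrow> (\<Sum>n<N. (norm (nth_ell2 (X j) n - l n))\<^sup>2)"
      by (intro tendsto_intros l)
    show "\<forall>\<^sub>F k in sequentially. (\<Sum>n<N. (norm (nth_ell2 (X j) n - nth_ell2 (X k) n))\<^sup>2) \<le> e\<^sup>2"
    proof (rule eventually_sequentiallyI)
      fix k assume "M \<le> k"
      have "(\<Sum>n<N. (norm (nth_ell2 (X j - X k) n))\<^sup>2) \<le> (norm (X j - X k))\<^sup>2"
        unfolding norm_ell2_sq by (rule sum_le_suminf[OF summable_nth_sq]) auto
      also have "\<dots> \<le> e\<^sup>2" using that[OF \<open>M \<le> k\<close>] by (intro power_mono) auto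
      finally show "(\<Sum>n<N. (norm (nth_ell2 (X j) n - nth_ell2 (X k) n))\<^sup>2) \<le> e\<^sup>2" by simp
    qed
  qed simp
  have summ: "summable (\<lambda>n. (norm (nth_ell2 (X j) n - l n))\<^sup>2)"
    if "\<And>k. k \<ge> M \<Longrightarrow> norm (X j - X k) \<le> e" for j M e
    using part[OF that] by (intro bounded_imp_summable[where B = "e\<^sup>2"]) (auto simp del: sum.lessThan_Suc simp flip: lessThan_Suc_atMost)
  \<comment> \<open>Comparison with a single late term \<open>X M\<close> shows that the
    coordinatewise limit is square-summable.\<close>
  obtain M where M: "\<And>j k. j \<ge> M \<Longrightarrow> k \<ge> M \<Longrightarrow> norm (X j - X k) < 1"
    using CauchyD[OF X, of 1] by auto
  then have "summable (\<lambda>n. (norm (nth_ell2 (X M) n - l n))\<^sup>2)"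
    by (intro summ[of M M 1]) (auto intro: less_imp_le)
  then have "summable (\<lambda>n. (norm (l n - nth_ell2 (X M) n))\<^sup>2)"
    by (simp only: norm_minus_commute)
  from square_summable_add[OF this summable_nth_sq[of "X M"]]
  have "summable (\<lambda>n. (norm (l n))\<^sup>2)" by simp
  then have L: "nth_ell2 (Abs_ell2 l) = l" by (simp add: Abs_ell2_inverse)
  define L where "L = Abs_ell2 l"
  note L = L[folded L_def]
  have "X \<longlonglongrightarrow> L"
  proof (rule LIMSEQ_I)
    fix r :: real assume "r > 0"
    then obtain M where M: "\<And>j k. j \<ge> M \<Longrightarrow> k \<ge> M \<Longrightarrow> norm (X j - X k) < r / 2"
      using CauchyD[OF X, of "r / 2"] by auto
    have "norm (X j - L) < r" if "j \<ge> M" for j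
    proof -
      have *: "\<And>k. k \<ge> M \<Longrightarrow> norm (X j - X k) \<le> r / 2"
        using M[OF that] by (auto intro: less_imp_le)
      have "(norm (X j - L))\<^sup>2 = (\<Sum>n. (norm (nth_ell2 (X j) n - l n))\<^sup>2)"
        by (simp add: norm_ell2_sq L)
      also have "\<dots> \<le> (r / 2)\<^sup>2"
        by (intro suminf_le_const[OF summ[of M j "r / 2"]] part[of M j "r / 2"] *)
      finally have "(norm (X j - L))\<^sup>2 \<le> (r / 2)\<^sup>2" .
      then have "norm (X j - L) \<le> r / 2"
        by (rule power2_le_imp_le) (use \<open>r > 0\<close> in simp)
      then show ?thesis using \<open>r > 0\<close> by simp
    qed
    then show "\<exists>no. \<forall>n\<ge>no. norm (X n - L) < r" by blast
  qed
  then show "convergent X" by (auto simp: convergent_def)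
qed

section \<open>Scalars, shifts and truncation on \<open>ell2\<close>\<close>

lift_definition cscale :: "complex \<Rightarrow> ell2 \<Rightarrow> ell2" is "\<lambda>c x n. c * x n"
  by (rule square_summable_mult)

lift_definition rshift :: "ell2 \<Rightarrow> ell2" is "\<lambda>x n. case n of 0 \<Rightarrow> 0 | Suc m \<Rightarrow> x m"
  by (subst summable_Suc_iff[symmetric]) simp

lift_definition lshift :: "ell2 \<Rightarrow> ell2" is "\<lambda>x n. x (Suc n)"
  by (subst summable_Suc_iff) simp

lift_definition trunc :: "nat \<Rightarrow> ell2 \<Rightarrow> ell2" is "\<lambda>N x n. if n < N then x n else 0"
  subgoal for N x by (rule summable_finite[of "{..<N}"]) auto
  done

text \<open>The coefficients of the constant function 1.\<close>

lift_definition unit0 :: ell2 is "\<lambda>n. if n = 0 then 1 else 0"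
  by (rule summable_finite[of "{0}"]) auto

lemma nth_ell2_ops [simp]:
  "nth_ell2 (cscale c x) n = c * nth_ell2 x n"
  "nth_ell2 (rshift x) 0 = 0" "nth_ell2 (rshift x) (Suc n) = nth_ell2 x n"
  "nth_ell2 (lshift x) n = nth_ell2 x (Suc n)"
  "nth_ell2 (trunc N x) n = (if n < N then nth_ell2 x n else 0)"
  "nth_ell2 unit0 n = (if n = 0 then 1 else 0)"
  by (simp_all add: cscale.rep_eq rshift.rep_eq lshift.rep_eq trunc.rep_eq unit0.rep_eq)

lemma norm_cscale [simp]: "norm (cscale c x) = norm c * norm x"
proof -
  have "(norm (cscale c x))\<^sup>2 = (norm c * norm x)\<^sup>2"
    unfolding power_mult_distrib norm_ell2_sq
    by (simp add: norm_mult power_mult_distrib suminf_mult summable_nth_sq)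
  then show ?thesis by (rule power2_eq_imp_eq) auto
qed

lemma norm_rshift [simp]: "norm (rshift x) = norm x"
proof -
  have "(norm (rshift x))\<^sup>2 = (norm x)\<^sup>2"
    unfolding norm_ell2_sq using suminf_split_head[OF summable_nth_sq, of "rshift x"] by simp
  then show ?thesis by (rule power2_eq_imp_eq) auto
qed

lemma rshift_lshift: "nth_ell2 x 0 = 0 \<Longrightarrow> rshift (lshift x) = x"
  by (rule ell2_eqI) (case_tac n, auto)

lemma norm_unit0 [simp]: "norm unit0 = 1"
proof -
  have "(norm unit0)\<^sup>2 = 1"
    unfolding norm_ell2_sq by (subst suminf_finite[of "{0}"]) auto
  then show ?thesis
    using norm_ge_zero[of unit0] unfolding power2_eq_1_iff by linarith
qed

text \<open>The squared error is the tail of a convergent series, namely the squared norm minus a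
  partial sum.\<close>

lemma trunc_tendsto: "(\<lambda>N. trunc N x) \<longlonglongrightarrow> x"
proof -
  have eq: "(norm (trunc N x - x))\<^sup>2 = (norm x)\<^sup>2 - (\<Sum>n<N. (norm (nth_ell2 x n))\<^sup>2)" for N
  proof -
    have "(norm (trunc N x - x))\<^sup>2 = (\<Sum>n. (norm (nth_ell2 (trunc N x - x) (n + N)))\<^sup>2)"
      unfolding norm_ell2_sq
      by (subst suminf_split_initial_segment[OF summable_nth_sq, of _ N]) simp
    also have "\<dots> = (\<Sum>n. (norm (nth_ell2 x (n + N)))\<^sup>2)" by simp
    finally show ?thesis
      unfolding norm_ell2_sq[of x]
      by (subst suminf_split_initial_segment[OF summable_nth_sq, of _ N]) simp
  qed
  have "(\<lambda>N. (norm x)\<^sup>2 - (\<Sum>n<N. (norm (nth_ell2 x n))\<^sup>2)) \<longlonglongrightarrow> (norm x)\<^sup>2 - (norm x)\<^sup>2"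
    by (intro tendsto_intros, unfold norm_ell2_sq[of x]) (rule summable_LIMSEQ[OF summable_nth_sq])
  then have "(\<lambda>N. (norm (trunc N x - x))\<^sup>2) \<longlonglongrightarrow> 0" by (simp add: eq)
  from tendsto_real_sqrt[OF this] have "(\<lambda>N. norm (trunc N x - x)) \<longlonglongrightarrow> 0" by simp
  then show ?thesis by (rule LIM_zero_cancel[OF tendsto_norm_zero_cancel])
qed

section \<open>Power series with square-summable coefficients\<close>

text \<open>Coefficient sequences stand for elements of \<open>H2\<close>. The value 0 outside the
  disc follows the convention of \<open>H2\<close>, so that two such functions are equal exactly
  when their coefficients are.\<close>

definition hfun :: "ell2 \<Rightarrow> complex \<Rightarrow> complex" where
  "hfun x z = (if z \<in> disc then \<Sum>n. nth_ell2 x n * z ^ n else 0)"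

lemma summable_norm_hfun:
  assumes "norm z < 1"
  shows "summable (\<lambda>n. norm (nth_ell2 x n * z ^ n))"
proof (rule summable_comparison_test')
  show "summable (\<lambda>n. norm x * norm z ^ n)"
    using assms by (intro summable_mult summable_geometric) simp
  show "norm (norm (nth_ell2 x n * z ^ n)) \<le> norm x * norm z ^ n" for n
    by (simp add: norm_mult norm_power mult_right_mono norm_nth_le)
qed

lemma hfun_sums:
  assumes "norm z < 1"
  shows "(\<lambda>n. nth_ell2 x n * z ^ n) sums hfun x z"
  using summable_sums[OF summable_norm_cancel[OF summable_norm_hfun[OF assms]]] assms
  by (simp add: hfun_def)

lemma hfun_outside: "z \<notin> disc \<Longrightarrow> hfun x z = 0"
  by (simp add: hfun_def)

text \<open>Each coefficient is bounded by the norm, which leaves a geometric series. This crude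
  bound makes evaluation at a point of the disc continuous.\<close>

lemma norm_hfun_le:
  assumes "norm z < 1"
  shows "norm (hfun x z) \<le> norm x / (1 - norm z)"
proof -
  have s: "summable (\<lambda>n. norm x * norm z ^ n)"
    using assms by (intro summable_mult summable_geometric) simp
  have "norm (\<Sum>n. nth_ell2 x n * z ^ n) \<le> (\<Sum>n. norm x * norm z ^ n)"
    by (intro norm_suminf_le s) (simp add: norm_mult norm_power mult_right_mono norm_nth_le)
  also have "\<dots> = norm x / (1 - norm z)"
    using assms by (subst suminf_mult) (auto intro!: summable_geometric simp: suminf_geometric)
  finally show ?thesis using assms by (simp add: hfun_def)
qed

lemma hfun_at_0 [simp]: "hfun x 0 = nth_ell2 x 0"
  by (simp add: hfun_def powser_zero)

lemma hfun_add: "hfun (x + y) z = hfun x z + hfun y z"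
  using sums_unique2[OF hfun_sums[of z "x + y"]] sums_add[OF hfun_sums[of z x] hfun_sums[of z y]]
  by (cases "norm z < 1") (auto simp: hfun_outside algebra_simps)

lemma hfun_cscale: "hfun (cscale c x) z = c * hfun x z"
  using sums_unique2[OF hfun_sums[of z "cscale c x"]] sums_mult[OF hfun_sums[of z x], of c]
  by (cases "norm z < 1") (auto simp: hfun_outside algebra_simps)

lemma cscale_minus_1: "cscale (- 1) x = - x"
  by (rule ell2_eqI) simp

lemma hfun_diff: "hfun (x - y) z = hfun x z - hfun y z"
  using hfun_add[of x "- y" z] hfun_cscale[of "- 1" y z] by (simp add: cscale_minus_1)

lemma hfun_unit0: "norm z < 1 \<Longrightarrow> hfun unit0 z = 1"
  using suminf_finite[of "{0}" "\<lambda>n. nth_ell2 unit0 n * z ^ n"] by (simp add: hfun_def)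

text \<open>The link between the coefficients and the derivatives at 0 by which \<open>coef\<close>
  is defined.\<close>

lemma hfun_has_fps_expansion: "hfun x has_fps_expansion Abs_fps (nth_ell2 x)"
proof -
  have "conv_radius (nth_ell2 x) \<ge> 1"
  proof (rule conv_radius_geI_ex)
    fix r :: real assume "0 < r" "ereal r < 1"
    then show "\<exists>z. norm z = r \<and> summable (\<lambda>n. nth_ell2 x n * z ^ n)"
      using sums_summable[OF hfun_sums[of "complex_of_real r" x]]
      by (intro exI[of _ "complex_of_real r"]) auto
  qed
  then have "fps_conv_radius (Abs_fps (nth_ell2 x)) > 0"
    by (simp add: fps_conv_radius_def less_le_trans[of 0 1] )
  moreover have "\<forall>\<^sub>F z in nhds 0. eval_fps (Abs_fps (nth_ell2 x)) z = hfun x z"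
    using eventually_nhds_in_open[of disc "0::complex"]
    by (auto elim!: eventually_mono simp: eval_fps_def hfun_def)
  ultimately show ?thesis by (auto simp: has_fps_expansion_def)
qed

lemma coef_hfun [simp]: "coef (hfun x) = nth_ell2 x"
  using fps_nth_fps_expansion[OF hfun_has_fps_expansion[of x]] by (auto simp: coef_def fun_eq_iff)

lemma hfun_inject: "hfun x = hfun y \<longleftrightarrow> x = y"
  by (metis coef_hfun nth_ell2_inject)

lemma hfun_holomorphic: "hfun x holomorphic_on disc"
proof -
  have "(\<lambda>z. \<Sum>n. nth_ell2 x n * z ^ n) holomorphic_on disc"
    using power_series_holomorphic[of 0 1 "nth_ell2 x" "\<lambda>z. \<Sum>n. nth_ell2 x n * z ^ n"]
      hfun_sums[of _ x] by (auto simp: hfun_def)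
  then show ?thesis by (rule holomorphic_transform) (simp add: hfun_def)
qed

lemma hfun_in_H2: "hfun x \<in> H2"
  by (simp add: H2_def hfun_holomorphic hfun_outside summable_nth_sq)

lemma H2_eq_range: "H2 = range hfun"
proof (intro equalityI subsetI)
  fix f assume f: "f \<in> H2"
  define x where "x = Abs_ell2 (coef f)"
  have x: "nth_ell2 x = coef f"
    using f unfolding x_def by (simp add: Abs_ell2_inverse H2_def)
  have "f z = hfun x z" for z
  proof (cases "z \<in> disc")
    case True
    then have "(\<lambda>n. coef f n * z ^ n) sums f z"
      using holomorphic_power_series[of f 0 1 z] f by (simp add: H2_def coef_def)
    with True show ?thesis by (simp add: hfun_def x sums_iff)
  next
    case False
    with f show ?thesis by (simp add: H2_def hfun_outside)
  qed
  then show "f \<in> range hfun" by (metis ext rangeI)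
qed (auto intro: hfun_in_H2)

lemma h2_norm_hfun: "h2_norm (hfun x) = norm x"
  by (simp add: h2_norm_def flip: norm_ell2_sq)

lemma h2_norm_hfun_diff: "h2_norm (\<lambda>z. hfun x z - hfun y z) = norm (x - y)"
  by (simp add: h2_norm_hfun flip: hfun_diff)

lemma hfun_rshift: "hfun (rshift x) z = z * hfun x z"
proof (cases "norm z < 1")
  case True
  have "(\<lambda>n. nth_ell2 (rshift x) (Suc n) * z ^ Suc n) sums (z * hfun x z)"
    using sums_mult[OF hfun_sums[OF True, of x], of z] by (simp add: mult_ac)
  then have "(\<lambda>n. nth_ell2 (rshift x) n * z ^ n) sums (z * hfun x z)"
    by (subst (asm) sums_Suc_iff) simp
  then show ?thesis using hfun_sums[OF True, of "rshift x"] sums_unique2 by blast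
qed (simp add: hfun_outside)

lemma shift_hfun: "shift (hfun x) = hfun (rshift x)"
  by (auto simp: shift_def fun_eq_iff hfun_rshift hfun_outside)

lemma bshift_hfun: "bshift (hfun x) = hfun (lshift x)"
proof
  fix z
  \<comment> \<open>Splitting off the constant term writes \<open>hfun x\<close> as a constant plus
    \<open>z\<close> times the series of \<open>lshift x\<close>; \<open>bshift\<close> recovers the
    second factor.\<close>
  have dec: "x = cscale (nth_ell2 x 0) unit0 + rshift (lshift x)"
    by (rule ell2_eqI, case_tac n) auto
  have "deriv (hfun x) 0 = nth_ell2 x 1"
    using fun_cong[OF coef_hfun[of x], of 1] unfolding coef_def by simp
  moreover have "hfun x z = nth_ell2 x 0 + z * hfun (lshift x) z" if "z \<in> disc"
    using that by (subst dec) (simp add: hfun_add hfun_cscale hfun_rshift hfun_unit0)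
  ultimately show "bshift (hfun x) z = hfun (lshift x) z"
    by (simp add: bshift_def hfun_outside)
qed

text \<open>Cauchy product of absolutely convergent series. The sequence \<open>y\<close> is given
  in advance because the convolution of two square-summable sequences need not be
  square-summable.\<close>

lemma hfun_eq_mult:
  assumes "\<And>n. nth_ell2 y n = (\<Sum>i\<le>n. nth_ell2 c i * nth_ell2 a (n - i))"
  shows "hfun y z = hfun c z * hfun a z"
proof (cases "norm z < 1")
  case True
  have "(\<lambda>k. \<Sum>i\<le>k. (nth_ell2 c i * z ^ i) * (nth_ell2 a (k - i) * z ^ (k - i)))
        sums ((\<Sum>k. nth_ell2 c k * z ^ k) * (\<Sum>k. nth_ell2 a k * z ^ k))"
    by (intro Cauchy_product_sums summable_norm_hfun True)
  moreover have "(\<Sum>i\<le>k. (nth_ell2 c i * z ^ i) * (nth_ell2 a (k - i) * z ^ (k - i)))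
      = nth_ell2 y k * z ^ k" for k
    unfolding assms sum_distrib_right
    by (rule sum.cong) (auto simp: mult_ac simp flip: power_add)
  ultimately have "(\<lambda>k. nth_ell2 y k * z ^ k) sums (hfun c z * hfun a z)"
    using True by (simp add: hfun_def)
  then show ?thesis using hfun_sums[OF True, of y] sums_unique2 by blast
qed (simp add: hfun_outside)

section \<open>Closed shift-invariant graphs\<close>

text \<open>A minimizing sequence is Cauchy by the parallelogram law, since midpoints stay in
  \<open>C\<close> and therefore have norm at least the infimum.\<close>

lemma closed_convex_min_norm:
  fixes C :: "'a::{real_inner, complete_space} set"
  assumes "closed C" "convex C" "C \<noteq> {}"
  obtains e where "e \<in> C" "\<And>g. g \<in> C \<Longrightarrow> norm e \<le> norm g"
proof -
  define d where "d = Inf (norm ` C)"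
  have bdd: "bdd_below (norm ` C)" by (rule bdd_belowI[of _ 0]) auto
  have d_le: "d \<le> norm g" if "g \<in> C" for g
    unfolding d_def by (rule cInf_lower) (use that bdd in auto)
  have d0: "0 \<le> d" unfolding d_def using assms by (intro cInf_greatest) auto
  have "\<exists>g\<in>C. norm g < d + 1 / real (Suc k)" for k
    using cInf_lessD[of "norm ` C" "d + 1 / real (Suc k)"] assms by (auto simp: d_def)
  then have "\<exists>X. \<forall>k. X k \<in> C \<and> norm (X k) < d + 1 / real (Suc k)"
    by (intro choice allI) blast
  then obtain X where X: "\<And>k. X k \<in> C" "\<And>k. norm (X k) < d + 1 / real (Suc k)" by blast
  \<comment> \<open>With \<open>s = 1 / Suc M\<close> both norms are at most \<open>d + s\<close>,
    so the parallelogram law leaves \<open>4 * (d + s)^2 - (2 * d)^2\<close>, that is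
    \<open>8 * d * s + 4 * s^2\<close>; since \<open>s \<le> 1\<close>, this is at most
    \<open>(8 * d + 4) * s\<close>.\<close>
  have key: "(norm (X j - X k))\<^sup>2 \<le> (8 * d + 4) * (1 / real (Suc M))" if "j \<ge> M" "k \<ge> M" for j k M
  proof -
    define s where "s = 1 / real (Suc M)"
    have s: "0 \<le> s" "s \<le> 1" by (auto simp: s_def)
    have sm: "norm (X i) \<le> d + s" if "i \<ge> M" for i
    proof -
      have "1 / real (Suc i) \<le> s" unfolding s_def using that by (intro divide_left_mono) auto
      then show ?thesis using X(2)[of i] by linarith
    qed
    have "(1/2) *\<^sub>R X j + (1/2) *\<^sub>R X k \<in> C"
      using assms(2) X(1) by (intro convexD) auto
    from d_le[OF this] have "d \<le> norm ((1/2) *\<^sub>R (X j + X k))" by (simp add: scaleR_add_right)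
    then have "2 * d \<le> norm (X j + X k)" by simp
    then have "(2 * d)\<^sup>2 \<le> (norm (X j + X k))\<^sup>2" using d0 by (intro power_mono) auto
    moreover have "(norm (X j - X k))\<^sup>2 + (norm (X j + X k))\<^sup>2 = 2 * (norm (X j))\<^sup>2 + 2 * (norm (X k))\<^sup>2"
      by (simp add: power2_norm_eq_inner inner_diff inner_add inner_commute algebra_simps)
    moreover have "(norm (X j))\<^sup>2 \<le> (d + s)\<^sup>2" "(norm (X k))\<^sup>2 \<le> (d + s)\<^sup>2"
      using sm[OF that(1)] sm[OF that(2)] by (auto intro!: power_mono)
    ultimately have "(norm (X j - X k))\<^sup>2 \<le> 4 * (d + s)\<^sup>2 - (2 * d)\<^sup>2"
      by linarith
    also have "\<dots> = 8 * d * s + 4 * (s * s)" by (simp add: power2_eq_square algebra_simps)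
    also have "\<dots> \<le> 8 * d * s + 4 * (s * 1)"
      using s by (intro add_left_mono mult_left_mono) auto
    finally show ?thesis unfolding s_def by (simp add: algebra_simps)
  qed
  have "Cauchy X"
  proof (rule CauchyI)
    fix r :: real assume "r > 0"
    obtain M where M: "(8 * d + 4) / r\<^sup>2 < real M" using reals_Archimedean2 by blast
    have "(8 * d + 4) / r\<^sup>2 < real (Suc M)" using M by linarith
    then have "(8 * d + 4) < r\<^sup>2 * real (Suc M)" using \<open>r > 0\<close> by (simp add: field_simps)
    then have "(8 * d + 4) * (1 / real (Suc M)) < r\<^sup>2" by (simp add: field_simps)
    then have "norm (X j - X k) < r" if "j \<ge> M" "k \<ge> M" for j k
      using key[OF that] \<open>r > 0\<close> by (intro power2_less_imp_less[of _ r]) auto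
    then show "\<exists>M. \<forall>m\<ge>M. \<forall>n\<ge>M. norm (X m - X n) < r" by blast
  qed
  then obtain e where e: "X \<longlonglongrightarrow> e" using Cauchy_convergent_iff convergent_def by blast
  have "e \<in> C" using closed_sequentially[OF assms(1) X(1) e] .
  moreover have "norm e \<le> d"
  proof (rule tendsto_le[OF sequentially_bot _ tendsto_norm[OF e]])
    show "(\<lambda>k. d + 1 / real (Suc k)) \<longlonglongrightarrow> d"
      using tendsto_add[OF tendsto_const[of d] LIMSEQ_Suc[OF lim_1_over_n]] by simp
    show "\<forall>\<^sub>F k in sequentially. norm (X k) \<le> d + 1 / real (Suc k)"
      using X(2) by (simp add: less_imp_le)
  qed
  ultimately show ?thesis using that d_le by (meson order_trans)
qed

section \<open>Pairs of sequences with componentwise operations\<close>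

type_synonym ell2_pair = "ell2 \<times> ell2"

definition cscale2 :: "complex \<Rightarrow> ell2_pair \<Rightarrow> ell2_pair" where
  "cscale2 c = map_prod (cscale c) (cscale c)"
definition rshift2 :: "ell2_pair \<Rightarrow> ell2_pair" where "rshift2 = map_prod rshift rshift"
definition lshift2 :: "ell2_pair \<Rightarrow> ell2_pair" where "lshift2 = map_prod lshift lshift"

lemma fst_snd_ops [simp]:
  "fst (cscale2 c g) = cscale c (fst g)" "snd (cscale2 c g) = cscale c (snd g)"
  "fst (rshift2 g) = rshift (fst g)" "snd (rshift2 g) = rshift (snd g)"
  "fst (lshift2 g) = lshift (fst g)" "snd (lshift2 g) = lshift (snd g)"
  by (simp_all add: cscale2_def rshift2_def lshift2_def)

lemma norm_pair_sq: "(norm g)\<^sup>2 = (norm (fst g))\<^sup>2 + (norm (snd g))\<^sup>2"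
  by (simp add: norm_prod_def)

lemma norm_cscale2 [simp]: "norm (cscale2 c g) = norm c * norm g"
proof -
  have "(norm (cscale2 c g))\<^sup>2 = (norm c * norm g)\<^sup>2"
    by (simp add: norm_pair_sq power_mult_distrib algebra_simps)
  then show ?thesis by (rule power2_eq_imp_eq) auto
qed

lemma norm_rshift2 [simp]: "norm (rshift2 g) = norm g"
  by (simp add: norm_prod_def)

lemma ell2_pair_eqI:
  assumes "\<And>n. nth_ell2 (fst g) n = nth_ell2 (fst h) n" "\<And>n. nth_ell2 (snd g) n = nth_ell2 (snd h) n"
  shows "g = h"
  using assms by (auto intro!: prod_eqI ell2_eqI)

lemma cscale2_scaleR: "cscale2 (of_real r) g = r *\<^sub>R g"
  by (rule ell2_pair_eqI) (simp_all add: scaleR_conv_of_real)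

lemma cscale2_cscale2: "cscale2 c (cscale2 d g) = cscale2 (c * d) g"
  by (rule ell2_pair_eqI) simp_all

lemma cscale2_1 [simp]: "cscale2 1 g = g"
  by (rule ell2_pair_eqI) simp_all

lemma cscale2_rshift2: "cscale2 c (rshift2 g) = rshift2 (cscale2 c g)"
  by (rule ell2_pair_eqI; case_tac n) simp_all

lemma rshift2_diff: "rshift2 (g - h) = rshift2 g - rshift2 h"
  by (rule ell2_pair_eqI; case_tac n) simp_all

text \<open>Scalars of modulus 1 preserve norms, and polarization transfers this to inner
  products.\<close>

lemma inner_cscale2: "norm c = 1 \<Longrightarrow> inner (cscale2 c g) (cscale2 c h) = inner g h"
proof -
  assume c: "norm c = 1"
  have "cscale2 c g + cscale2 c h = cscale2 c (g + h)"
    by (rule ell2_pair_eqI) (simp_all add: algebra_simps)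
  then have "norm (cscale2 c g + cscale2 c h) = norm (g + h)" by (simp add: c)
  then show ?thesis
    using dot_norm[of "cscale2 c g" "cscale2 c h"] dot_norm[of g h] by (simp add: c)
qed

text \<open>Graphs of closed operators that commute with multiplication by \<open>z\<close> and are divisible at the origin.\<close>

locale shift_graph =
  fixes G :: "ell2_pair set"
  assumes closed: "closed G"
    and add: "g \<in> G \<Longrightarrow> h \<in> G \<Longrightarrow> g + h \<in> G"
    and scale: "g \<in> G \<Longrightarrow> cscale2 c g \<in> G"
    and shift: "g \<in> G \<Longrightarrow> rshift2 g \<in> G"
    and divide: "g \<in> G \<Longrightarrow> nth_ell2 (fst g) 0 = 0 \<Longrightarrow> nth_ell2 (snd g) 0 = 0 \<and> lshift2 g \<in> G"
    and nontrivial: "\<exists>g\<in>G. nth_ell2 (fst g) 0 \<noteq> 0"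
begin

lemma diff: "g \<in> G \<Longrightarrow> h \<in> G \<Longrightarrow> g - h \<in> G"
  using add[of g "cscale2 (-1) h"] scale[of h "-1"] cscale2_scaleR[of "-1" h] by simp

lemma zero: "0 \<in> G"
  using nontrivial diff by (metis cancel_comm_monoid_add_class.diff_cancel)

lemma scaleR: "g \<in> G \<Longrightarrow> r *\<^sub>R g \<in> G"
  using scale[of g "of_real r"] by (simp add: cscale2_scaleR)

lemma rshift2_lshift2:
  "g \<in> G \<Longrightarrow> nth_ell2 (fst g) 0 = 0 \<Longrightarrow> rshift2 (lshift2 g) = g"
  using divide[of g] by (auto intro!: prod_eqI rshift_lshift)

text \<open>Among the elements of \<open>G\<close> whose first component is 1 at the origin there is
  one of least norm, and it is normalized. Shifted elements vanish at the origin, so adding a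
  multiple of one stays in this set, and minimality forces orthogonality.\<close>

lemma unit_wandering_vector:
  obtains e where "e \<in> G" "norm e = 1" "nth_ell2 (fst e) 0 \<noteq> 0"
    "\<And>g. g \<in> G \<Longrightarrow> inner e (rshift2 g) = 0"
proof -
  define C where "C = G \<inter> {g. nth_ell2 (fst g) 0 = 1}"
  have cont: "continuous_on UNIV (\<lambda>g::ell2_pair. nth_ell2 (fst g) 0)"
    by (intro linear_continuous_on bounded_linear_compose[OF bounded_linear_nth bounded_linear_fst])
  have "closed {g::ell2_pair. nth_ell2 (fst g) 0 = 1}"
    using cont by (intro closed_Collect_eq continuous_on_const)
  then have "closed C" unfolding C_def by (intro closed_Int closed)
  moreover have "convex C"
    by (rule convexI) (auto simp: C_def add scaleR scaleR_conv_of_real simp flip: of_real_add)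
  moreover have "C \<noteq> {}"
  proof -
    obtain g where "g \<in> G" "nth_ell2 (fst g) 0 \<noteq> 0" using nontrivial by blast
    then have "cscale2 (1 / nth_ell2 (fst g) 0) g \<in> C" by (simp add: C_def scale)
    then show ?thesis by blast
  qed
  ultimately obtain e where e: "e \<in> C" and min: "\<And>g. g \<in> C \<Longrightarrow> norm e \<le> norm g"
    using closed_convex_min_norm by blast
  have eG: "e \<in> G" and e0: "nth_ell2 (fst e) 0 = 1" using e by (auto simp: C_def)
  have ne: "norm e > 0"
  proof (rule ccontr)
    assume "\<not> norm e > 0"
    then have "e = 0" by simp
    then have "nth_ell2 (fst e) 0 = 0" by simp
    with e0 show False by simp
  qed
  have orth: "inner e (rshift2 g) = 0" if "g \<in> G" for g
  proof (cases "g = 0")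
    case True
    then have "norm (rshift2 g) = 0" by simp
    then have "rshift2 g = 0" unfolding norm_eq_zero .
    then show ?thesis by simp
  next
    case False
    define y where "y = rshift2 g"
    have ny: "norm y > 0" using False by (simp add: y_def)
    \<comment> \<open>The minimizer of the squared norm along the line \<open>e + t y\<close>; it
      lowers the squared norm by \<open>(inner e y)^2 / (norm y)^2\<close>.\<close>
    define t where "t = - inner e y / (norm y)\<^sup>2"
    have "e + t *\<^sub>R y \<in> C"
      using eG e0 that by (auto simp: C_def y_def intro!: add scaleR shift)
    from min[OF this] have "(norm e)\<^sup>2 \<le> (norm (e + t *\<^sub>R y))\<^sup>2"
      by (intro power_mono) auto
    also have "\<dots> = (norm e)\<^sup>2 + 2 * t * inner e y + t\<^sup>2 * (norm y)\<^sup>2"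
      unfolding power2_norm_eq_inner by (simp add: inner_add inner_commute algebra_simps power2_eq_square)
    also have "\<dots> = (norm e)\<^sup>2 - (inner e y)\<^sup>2 / (norm y)\<^sup>2"
      using ny by (simp add: t_def field_simps power2_eq_square)
    finally have "(inner e y)\<^sup>2 / (norm y)\<^sup>2 \<le> 0" by simp
    then show ?thesis using ny by (simp add: y_def divide_le_0_iff)
  qed
  show ?thesis
  proof (rule that[of "(1 / norm e) *\<^sub>R e"])
    show "(1 / norm e) *\<^sub>R e \<in> G" by (intro scaleR eG)
    show "norm ((1 / norm e) *\<^sub>R e) = 1" using ne by simp
    show "nth_ell2 (fst ((1 / norm e) *\<^sub>R e)) 0 \<noteq> 0" using ne e0 by simp
    show "inner ((1 / norm e) *\<^sub>R e) (rshift2 g) = 0" if "g \<in> G" for g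
      using orth[OF that] by simp
  qed
qed

end

section \<open>Wold decomposition relative to a wandering unit vector\<close>

locale shift_graph_generator = shift_graph +
  fixes e :: ell2_pair
  assumes e_in: "e \<in> G" and norm_e: "norm e = 1" and e_0: "nth_ell2 (fst e) 0 \<noteq> 0"
    and orth: "\<And>g. g \<in> G \<Longrightarrow> inner e (rshift2 g) = 0"
begin

text \<open>The assumption \<open>orth\<close> concerns the real inner product. It extends to
  complex multiples of \<open>e\<close> because the scalar \<open>c\<close> can be rotated to a
  nonnegative real, the inverse rotation being absorbed into \<open>g\<close> without leaving
  \<open>G\<close>.\<close>

lemma pythagoras:
  assumes "g \<in> G"
  shows "(norm (cscale2 c e + rshift2 g))\<^sup>2 = (norm c)\<^sup>2 + (norm g)\<^sup>2"
proof -
  have "inner (cscale2 c e) (rshift2 g) = 0"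
  proof (cases "c = 0")
    case True
    then have "norm (cscale2 c e) = 0" by simp
    then have "cscale2 c e = 0" unfolding norm_eq_zero .
    then show ?thesis by simp
  next
    case False
    define u where "u = c / of_real (norm c)"
    have u: "norm u = 1" "u \<noteq> 0" "c = norm c * u" using False by (auto simp: u_def norm_divide)
    have c: "cscale2 c e = norm c *\<^sub>R cscale2 u e"
      by (subst u(3)) (simp add: cscale2_cscale2 flip: cscale2_scaleR)
    have "rshift2 g = cscale2 u (rshift2 (cscale2 (1 / u) g))"
      using u(2) by (simp add: cscale2_rshift2 cscale2_cscale2)
    then have "inner (cscale2 u e) (rshift2 g) = inner e (rshift2 (cscale2 (1 / u) g))"
      using inner_cscale2[OF u(1)] by metis
    also have "\<dots> = 0" by (intro orth scale assms)
    finally show ?thesis by (simp add: c)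
  qed
  then have "(norm (cscale2 c e + rshift2 g))\<^sup>2 = (norm (cscale2 c e))\<^sup>2 + (norm (rshift2 g))\<^sup>2"
    by (simp add: power2_norm_eq_inner inner_add inner_commute del: norm_cscale2 norm_rshift2)
  then show ?thesis by (simp add: norm_e power_mult_distrib)
qed

text \<open>Horner scheme for the product of \<open>e\<close> with the polynomial formed by the
  first \<open>n\<close> coefficients of \<open>c\<close>. Each recursion step has the shape to
  which \<open>pythagoras\<close> applies.\<close>

primrec partial_mult :: "nat \<Rightarrow> ell2 \<Rightarrow> ell2_pair" where
  "partial_mult 0 c = 0"
| "partial_mult (Suc n) c = cscale2 (nth_ell2 c 0) e + rshift2 (partial_mult n (lshift c))"

lemma partial_mult_in: "partial_mult n c \<in> G"
  by (induction n arbitrary: c) (auto intro: zero add scale shift e_in)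

lemma norm_partial_mult: "(norm (partial_mult n c))\<^sup>2 = (\<Sum>k<n. (norm (nth_ell2 c k))\<^sup>2)"
  by (induction n arbitrary: c)
     (simp_all add: pythagoras partial_mult_in sum.lessThan_Suc_shift del: sum.lessThan_Suc)

lemma norm_partial_mult_le: "norm (partial_mult n c) \<le> norm c"
proof (rule power2_le_imp_le)
  show "(norm (partial_mult n c))\<^sup>2 \<le> (norm c)\<^sup>2"
    unfolding norm_partial_mult norm_ell2_sq by (rule sum_le_suminf[OF summable_nth_sq]) auto
qed simp

lemma partial_mult_diff: "partial_mult n c - partial_mult n d = partial_mult n (c - d)"
proof (induction n arbitrary: c d)
  case (Suc n)
  have "lshift (c - d) = lshift c - lshift d" by (rule ell2_eqI) simp
  moreover have "cscale2 (s - t) e = cscale2 s e - cscale2 t e" for s t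
    by (rule ell2_pair_eqI) (simp_all add: algebra_simps)
  ultimately show ?case
    by (simp add: rshift2_diff flip: Suc)
qed simp

text \<open>Together with \<open>partial_mult_diff\<close> this turns the difference of two partial
  products of different lengths into one partial product with a tail of \<open>c\<close>, whose norm
  controls it.\<close>

lemma partial_mult_trunc: "m \<le> n \<Longrightarrow> partial_mult m c = partial_mult n (trunc m c)"
proof (induction m arbitrary: n c)
  case 0
  have "trunc 0 c = 0" by (rule ell2_eqI) simp
  then show ?case using norm_partial_mult_le[of n "trunc 0 c"] by simp
next
  case (Suc m)
  then obtain n' where n: "n = Suc n'" "m \<le> n'" by (cases n) auto
  have "lshift (trunc (Suc m) c) = trunc m (lshift c)" by (rule ell2_eqI) simp
  then show ?case using Suc.IH[OF n(2)] by (simp add: n)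
qed

text \<open>Coefficients below \<open>n\<close> are already final, so the coordinatewise limits in
  \<open>multiple_in\<close> are limits of eventually constant sequences.\<close>

lemma nth_partial_mult:
  assumes "m < n"
  shows "nth_ell2 (fst (partial_mult n c)) m = (\<Sum>i\<le>m. nth_ell2 c i * nth_ell2 (fst e) (m - i))"
    and "nth_ell2 (snd (partial_mult n c)) m = (\<Sum>i\<le>m. nth_ell2 c i * nth_ell2 (snd e) (m - i))"
  using assms
proof (induction m arbitrary: n c)
  case 0
  { case 1 then show ?case by (cases n) auto }
  { case 2 then show ?case by (cases n) auto }
next
  case (Suc m)
  { case 1 then show ?case
      by (cases n) (auto simp: Suc.IH sum.atMost_Suc_shift simp del: sum.atMost_Suc) }
  { case 2 then show ?case
      by (cases n) (auto simp: Suc.IH sum.atMost_Suc_shift simp del: sum.atMost_Suc) }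
qed

text \<open>The partial products are Cauchy because they differ by products with tails of
  \<open>c\<close>. Their limit lies in the closed set \<open>G\<close>, and the norm identity
  \<open>norm_partial_mult\<close> passes to the limit.\<close>

lemma multiple_in:
  obtains g where "g \<in> G" "norm g = norm c"
    "\<And>m. nth_ell2 (fst g) m = (\<Sum>i\<le>m. nth_ell2 c i * nth_ell2 (fst e) (m - i))"
    "\<And>m. nth_ell2 (snd g) m = (\<Sum>i\<le>m. nth_ell2 c i * nth_ell2 (snd e) (m - i))"
proof -
  have le: "norm (partial_mult n c - partial_mult m c) \<le> norm (c - trunc m c)" if "m \<le> n" for m n
    by (metis norm_partial_mult_le partial_mult_diff partial_mult_trunc that)
  have "Cauchy (\<lambda>n. partial_mult n c)"
  proof (rule CauchyI)
    fix r :: real assume "r > 0"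
    then obtain M where M: "\<And>m. m \<ge> M \<Longrightarrow> norm (trunc m c - c) < r / 2"
      using LIMSEQ_D[OF trunc_tendsto[of c], of "r / 2"] by auto
    have M': "norm (partial_mult n c - partial_mult M c) < r / 2" if "n \<ge> M" for n
      using le[OF that] M[of M] by (simp add: norm_minus_commute)
    have "norm (partial_mult m c - partial_mult n c) < r" if "m \<ge> M" "n \<ge> M" for m n
      using norm_diff_triangle_less[OF M'[OF that(1)], of "partial_mult n c" "r / 2"]
        M'[OF that(2)] by (simp add: norm_minus_commute)
    then show "\<exists>M. \<forall>m\<ge>M. \<forall>n\<ge>M. norm (partial_mult m c - partial_mult n c) < r" by blast
  qed
  then obtain g where g: "(\<lambda>n. partial_mult n c) \<longlonglongrightarrow> g"
    using Cauchy_convergent_iff convergent_def by blast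
  have "g \<in> G" using closed_sequentially[OF closed partial_mult_in g] .
  moreover have "norm g = norm c"
  proof -
    have "(\<lambda>n. (norm (partial_mult n c))\<^sup>2) \<longlonglongrightarrow> (norm c)\<^sup>2"
      unfolding norm_partial_mult norm_ell2_sq by (rule summable_LIMSEQ[OF summable_nth_sq])
    moreover have "(\<lambda>n. (norm (partial_mult n c))\<^sup>2) \<longlonglongrightarrow> (norm g)\<^sup>2"
      by (intro tendsto_intros g)
    ultimately have "(norm g)\<^sup>2 = (norm c)\<^sup>2" using LIMSEQ_unique by blast
    then show ?thesis by (rule power2_eq_imp_eq) auto
  qed
  moreover have "nth_ell2 (fst g) m = (\<Sum>i\<le>m. nth_ell2 c i * nth_ell2 (fst e) (m - i))" for m
  proof -
    have lim: "(\<lambda>n. nth_ell2 (fst (partial_mult n c)) m) \<longlonglongrightarrow> nth_ell2 (fst g) m"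
      by (intro bounded_linear.tendsto[OF bounded_linear_nth] tendsto_fst g)
    have ev: "\<forall>\<^sub>F n in sequentially. nth_ell2 (fst (partial_mult n c)) m
        = (\<Sum>i\<le>m. nth_ell2 c i * nth_ell2 (fst e) (m - i))"
      by (rule eventually_sequentiallyI[of "Suc m"]) (simp add: nth_partial_mult(1))
    show ?thesis by (rule LIMSEQ_unique[OF lim tendsto_eventually[OF ev]])
  qed
  moreover have "nth_ell2 (snd g) m = (\<Sum>i\<le>m. nth_ell2 c i * nth_ell2 (snd e) (m - i))" for m
  proof -
    have lim: "(\<lambda>n. nth_ell2 (snd (partial_mult n c)) m) \<longlonglongrightarrow> nth_ell2 (snd g) m"
      by (intro bounded_linear.tendsto[OF bounded_linear_nth] tendsto_snd g)
    have ev: "\<forall>\<^sub>F n in sequentially. nth_ell2 (snd (partial_mult n c)) m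
        = (\<Sum>i\<le>m. nth_ell2 c i * nth_ell2 (snd e) (m - i))"
      by (rule eventually_sequentiallyI[of "Suc m"]) (simp add: nth_partial_mult(2))
    show ?thesis by (rule LIMSEQ_unique[OF lim tendsto_eventually[OF ev]])
  qed
  ultimately show ?thesis by (rule that)
qed

text \<open>Division by \<open>e\<close>: for \<open>g\<close> in \<open>G\<close>, subtracting this
  multiple of \<open>e\<close> cancels the constant term of the first component, so the difference
  is \<open>z\<close> times an element of \<open>G\<close>, the \<open>remainder\<close>.\<close>

definition quot :: "ell2_pair \<Rightarrow> complex" where
  "quot g = nth_ell2 (fst g) 0 / nth_ell2 (fst e) 0"

definition remainder :: "ell2_pair \<Rightarrow> ell2_pair" where
  "remainder g = lshift2 (g - cscale2 (quot g) e)"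

lemma remainder:
  assumes "g \<in> G"
  shows "remainder g \<in> G" and "cscale2 (quot g) e + rshift2 (remainder g) = g"
proof -
  have *: "g - cscale2 (quot g) e \<in> G" "nth_ell2 (fst (g - cscale2 (quot g) e)) 0 = 0"
    using assms e_0 by (auto intro!: diff scale e_in simp: quot_def)
  show "remainder g \<in> G" using divide[OF *] by (simp add: remainder_def)
  show "cscale2 (quot g) e + rshift2 (remainder g) = g"
    using rshift2_lshift2[OF *] by (simp add: remainder_def)
qed

lemma remainder_iter: "g \<in> G \<Longrightarrow> (remainder ^^ n) g \<in> G"
  by (induction n) (auto intro: remainder)

text \<open>Repeated division by \<open>e\<close> produces the Taylor coefficients of the
  multiplier. At a fixed index only finitely many divisions matter, so no convergence is
  involved.\<close>

lemma nth_eq_quot: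
  assumes "g \<in> G"
  shows "nth_ell2 (fst g) m = (\<Sum>i\<le>m. quot ((remainder ^^ i) g) * nth_ell2 (fst e) (m - i))"
    and "nth_ell2 (snd g) m = (\<Sum>i\<le>m. quot ((remainder ^^ i) g) * nth_ell2 (snd e) (m - i))"
  using assms
proof (induction m arbitrary: g)
  case 0
  { case 1 show ?case
      by (subst remainder(2)[OF 1, symmetric]) simp }
  { case 2 show ?case
      by (subst remainder(2)[OF 2, symmetric]) simp }
next
  case (Suc m)
  { case 1 show ?case
      by (subst remainder(2)[OF 1, symmetric])
         (simp add: Suc.IH remainder(1)[OF 1] sum.atMost_Suc_shift funpow_Suc_right
           del: sum.atMost_Suc funpow.simps) }
  { case 2 show ?case
      by (subst remainder(2)[OF 2, symmetric])
         (simp add: Suc.IH remainder(1)[OF 2] sum.atMost_Suc_shift funpow_Suc_right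
           del: sum.atMost_Suc funpow.simps) }
qed

text \<open>Each division step splits the norm by \<open>pythagoras\<close>; this bounds the sum of
  the squared quotients by the norm of \<open>g\<close>.\<close>

lemma sum_quot_remainder:
  assumes "g \<in> G"
  shows "(\<Sum>i<n. (norm (quot ((remainder ^^ i) g)))\<^sup>2) + (norm ((remainder ^^ n) g))\<^sup>2 = (norm g)\<^sup>2"
proof (induction n)
  case (Suc n)
  let ?h = "(remainder ^^ n) g"
  have "(norm ?h)\<^sup>2 = (norm (quot ?h))\<^sup>2 + (norm (remainder ?h))\<^sup>2"
    using pythagoras[OF remainder(1)[OF remainder_iter[OF assms, of n]], of "quot ?h"]
      remainder(2)[OF remainder_iter[OF assms, of n]] by simp
  then show ?case using Suc by simp
qed simp

text \<open>The iterated quotients of \<open>g\<close> form a square-summable \<open>c\<close>, and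
  the element that \<open>multiple_in\<close> builds from \<open>c\<close> has the same coefficients
  as \<open>g\<close>. This is the Wold decomposition with one-dimensional wandering space.\<close>

theorem graph_eq_multiples:
  "g \<in> G \<longleftrightarrow> (\<exists>c. norm g = norm c \<and> (\<forall>z. hfun (fst g) z = hfun c z * hfun (fst e) z)
                              \<and> (\<forall>z. hfun (snd g) z = hfun c z * hfun (snd e) z))"
    (is "?l \<longleftrightarrow> ?r")
proof
  assume g: "g \<in> G"
  have "summable (\<lambda>i. (norm (quot ((remainder ^^ i) g)))\<^sup>2)"
  proof (rule bounded_imp_summable)
    fix n
    show "(\<Sum>i\<le>n. (norm (quot ((remainder ^^ i) g)))\<^sup>2) \<le> (norm g)\<^sup>2"
      using sum_quot_remainder[OF g, of "Suc n"] unfolding lessThan_Suc_atMost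
      by (metis add.commute le_add_same_cancel2 zero_le_power2)
  qed simp
  then have c: "nth_ell2 (Abs_ell2 (\<lambda>i. quot ((remainder ^^ i) g))) i = quot ((remainder ^^ i) g)" for i
    by (simp add: Abs_ell2_inverse)
  define c where "c = Abs_ell2 (\<lambda>i. quot ((remainder ^^ i) g))"
  note c = c[folded c_def]
  obtain h where h: "h \<in> G" "norm h = norm c"
    "\<And>m. nth_ell2 (fst h) m = (\<Sum>i\<le>m. nth_ell2 c i * nth_ell2 (fst e) (m - i))"
    "\<And>m. nth_ell2 (snd h) m = (\<Sum>i\<le>m. nth_ell2 c i * nth_ell2 (snd e) (m - i))"
    using multiple_in[of c] by blast
  have "h = g" by (rule ell2_pair_eqI) (simp_all add: h(3,4) nth_eq_quot[OF g] c)
  then show ?r using h hfun_eq_mult by blast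
next
  assume ?r
  then obtain c where c: "\<And>z. hfun (fst g) z = hfun c z * hfun (fst e) z"
    "\<And>z. hfun (snd g) z = hfun c z * hfun (snd e) z" by blast
  obtain h where h: "h \<in> G" "norm h = norm c"
    "\<And>m. nth_ell2 (fst h) m = (\<Sum>i\<le>m. nth_ell2 c i * nth_ell2 (fst e) (m - i))"
    "\<And>m. nth_ell2 (snd h) m = (\<Sum>i\<le>m. nth_ell2 c i * nth_ell2 (snd e) (m - i))"
    using multiple_in[of c] by blast
  have "hfun (fst h) = hfun (fst g)" "hfun (snd h) = hfun (snd g)"
    using hfun_eq_mult[OF h(3)] hfun_eq_mult[OF h(4)] c by auto
  then have "h = g" by (simp add: hfun_inject prod_eq_iff)
  with h(1) show ?l by simp
qed

lemma multiple_exists: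
  obtains g where "g \<in> G" "norm g = norm c"
    "\<And>z. hfun (fst g) z = hfun c z * hfun (fst e) z" "\<And>z. hfun (snd g) z = hfun c z * hfun (snd e) z"
proof -
  obtain g where g: "g \<in> G" "norm g = norm c"
    "\<And>m. nth_ell2 (fst g) m = (\<Sum>i\<le>m. nth_ell2 c i * nth_ell2 (fst e) (m - i))"
    "\<And>m. nth_ell2 (snd g) m = (\<Sum>i\<le>m. nth_ell2 c i * nth_ell2 (snd e) (m - i))"
    using multiple_in[of c] by blast
  show ?thesis by (rule that[OF g(1,2) hfun_eq_mult[OF g(3)] hfun_eq_mult[OF g(4)]])
qed

text \<open>Multiplication by \<open>e\<close> is isometric into pairs, so each component acts as a
  contraction on the Hardy space.\<close>

lemma multiplier_bound:
  assumes "norm z < 1"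
  shows "norm (hfun (fst e) z) \<le> 1" and "norm (hfun (snd e) z) \<le> 1"
proof -
  \<comment> \<open>A contractive multiplier has power-bounded values at each point of the disc.\<close>
  have bound: "norm (\<phi> z) \<le> 1"
    if "\<And>c. \<exists>d. norm d \<le> norm c \<and> (\<forall>z. hfun d z = hfun c z * \<phi> z)" for \<phi> :: "complex \<Rightarrow> complex"
  proof (rule ccontr)
    assume "\<not> norm (\<phi> z) \<le> 1"
    have pow: "\<exists>d. norm d \<le> 1 \<and> (\<forall>z. norm z < 1 \<longrightarrow> hfun d z = \<phi> z ^ n)" for n
    proof (induction n)
      case 0
      then show ?case by (intro exI[of _ unit0]) (simp add: hfun_unit0)
    next
      case (Suc n)
      then obtain c where "norm c \<le> 1" "\<And>z. norm z < 1 \<Longrightarrow> hfun c z = \<phi> z ^ n" by blast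
      then show ?case using that[of c] by (metis order_trans power_Suc2)
    qed
    have "norm (\<phi> z) ^ n \<le> 1 / (1 - norm z)" for n
    proof -
      obtain d where d: "norm d \<le> 1" "hfun d z = \<phi> z ^ n" using pow[of n] assms by blast
      have "norm (\<phi> z) ^ n = norm (hfun d z)" by (simp add: d norm_power)
      also have "\<dots> \<le> norm d / (1 - norm z)" by (rule norm_hfun_le[OF assms])
      also have "\<dots> \<le> 1 / (1 - norm z)" using d assms by (intro divide_right_mono) auto
      finally show ?thesis .
    qed
    moreover obtain n where "1 / (1 - norm z) < norm (\<phi> z) ^ n"
      using real_arch_pow[of "norm (\<phi> z)"] \<open>\<not> norm (\<phi> z) \<le> 1\<close> by (auto simp: not_le)
    ultimately show False by (simp add: leD)
  qed
  have "norm (fst g) \<le> norm g" "norm (snd g) \<le> norm g" for g :: ell2_pair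
    using norm_fst_le norm_snd_le by (metis prod.collapse)+
  then have "\<exists>d. norm d \<le> norm c \<and> (\<forall>z. hfun d z = hfun c z * hfun (fst e) z)"
    "\<exists>d. norm d \<le> norm c \<and> (\<forall>z. hfun d z = hfun c z * hfun (snd e) z)" for c
    using multiple_exists[of c] by metis+
  then show "norm (hfun (fst e) z) \<le> 1" "norm (hfun (snd e) z) \<le> 1"
    using bound by blast+
qed

end

section \<open>Integrals over the circle\<close>

text \<open>The angle interval used in \<open>outer\<close>, without normalization, so that means
  carry a factor \<open>2 * pi\<close>.\<close>

definition circ :: "real measure" where "circ = restrict_space lborel {0..2 * pi}"

lemma space_circ [simp]: "space circ = {0..2 * pi}"
  by (simp add: circ_def space_restrict_space)

lemma finite_measure_circ: "finite_measure circ"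
  by (rule finite_measureI) (simp add: circ_def emeasure_restrict_space space_restrict_space)

interpretation circ: finite_measure circ
  by (rule finite_measure_circ)

lemma measure_circ_space [simp]: "measure circ {0..2 * pi} = 2 * pi"
  by (simp add: circ_def measure_restrict_space)

lemma integrable_circ_iff: "integrable circ f \<longleftrightarrow> set_integrable lborel {0..2 * pi} f"
  for f :: "real \<Rightarrow> 'b::{banach, second_countable_topology}"
  unfolding circ_def set_integrable_def by (rule integrable_restrict_space) simp

lemma integral_circ_eq: "integral\<^sup>L circ f = (LINT t:{0..2 * pi}|lborel. f t)"
  for f :: "real \<Rightarrow> 'b::{banach, second_countable_topology}"
  unfolding circ_def set_lebesgue_integral_def by (rule integral_restrict_space) simp

lemma integrable_circ_continuous:
  fixes f :: "real \<Rightarrow> 'b::{banach, second_countable_topology}"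
  assumes "continuous_on {0..2 * pi} f"
  shows "integrable circ f"
  unfolding integrable_circ_iff using assms by (rule borel_integrable_atLeastAtMost')

lemma integrable_circ_comp_cis:
  fixes F :: "complex \<Rightarrow> 'b::{banach, second_countable_topology}"
  assumes "continuous_on (cball 0 1) F"
  shows "integrable circ (\<lambda>t. F (cis t))"
  by (intro integrable_circ_continuous continuous_on_compose2[OF assms] continuous_intros) auto

text \<open>The kernel is the Cauchy kernel times the derivative of \<open>cis\<close>, divided by
  \<open>\<i>\<close>.\<close>

lemma Cauchy_integral_circ:
  fixes F :: "complex \<Rightarrow> complex"
  assumes "continuous_on (cball 0 1) F" "F holomorphic_on ball 0 1" "norm w < 1"
  shows "integral\<^sup>L circ (\<lambda>t. F (cis t) * (cis t / (cis t - w))) = 2 * pi * F w"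
proof -
  have ne: "cis t \<noteq> w" for t using assms(3) by auto
  have "((\<lambda>u. F u / (u - w)) has_contour_integral (2 * of_real pi * \<i> * F w)) (circlepath 0 1)"
    using assms by (intro Cauchy_integral_circlepath) auto
  then have "((\<lambda>t. F (cis t) / (cis t - w) * \<i> * cis t) has_integral (2 * of_real pi * \<i> * F w)) {0..2 * pi}"
    unfolding circlepath_def by (subst (asm) has_contour_integral_part_circlepath_iff) auto
  from has_integral_mult_right[OF this, of "- \<i>"]
  have "((\<lambda>t. F (cis t) * (cis t / (cis t - w))) has_integral (2 * of_real pi * F w)) {0..2 * pi}"
    by (simp add: mult_ac)
  then have "integral {0..2 * pi} (\<lambda>t. F (cis t) * (cis t / (cis t - w))) = 2 * of_real pi * F w"
    by (rule integral_unique)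
  moreover have "set_integrable lborel {0..2 * pi} (\<lambda>t. F (cis t) * (cis t / (cis t - w)))"
    using ne by (intro borel_integrable_atLeastAtMost' continuous_intros
        continuous_on_compose2[OF assms(1)]) auto
  ultimately show ?thesis
    unfolding integral_circ_eq by (simp add: set_borel_integral_eq_integral)
qed

lemma mean_value_circ:
  fixes F :: "complex \<Rightarrow> complex"
  assumes "continuous_on (cball 0 1) F" "F holomorphic_on ball 0 1"
  shows "integral\<^sup>L circ (\<lambda>t. F (cis t)) = 2 * pi * F 0"
  using Cauchy_integral_circ[OF assms, of 0] by simp

lemma mean_value_Re_circ:
  fixes F :: "complex \<Rightarrow> complex"
  assumes "continuous_on (cball 0 1) F" "F holomorphic_on ball 0 1"
  shows "integral\<^sup>L circ (\<lambda>t. Re (F (cis t))) = 2 * pi * Re (F 0)"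
proof -
  have "integral\<^sup>L circ (\<lambda>t. Re (F (cis t))) = Re (integral\<^sup>L circ (\<lambda>t. F (cis t)))"
    by (rule integral_bounded_linear[OF bounded_linear_Re integrable_circ_comp_cis[OF assms(1)]])
  then show ?thesis by (simp add: mean_value_circ[OF assms])
qed

text \<open>The kernel is twice the Cauchy kernel minus 1, while its conjugate is the boundary value
  of a holomorphic function equal to 1 at the origin. Integrating the kernel against
  \<open>F\<close> and against the conjugate of \<open>F\<close> and averaging the results gives the
  formula.\<close>

lemma Schwarz_integral_circ:
  fixes F :: "complex \<Rightarrow> complex"
  assumes "continuous_on (cball 0 1) F" "F holomorphic_on ball 0 1" "norm z < 1"
  shows "F z = \<i> * Im (F 0) + (1 / (2 * pi)) *
    integral\<^sup>L circ (\<lambda>t. (cis t + z) / (cis t - z) * of_real (Re (F (cis t))))"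
proof -
  have ne: "cis t \<noteq> z" for t using assms(3) by auto
  define H where "H = (\<lambda>t. (cis t + z) / (cis t - z))"
  have contF: "continuous_on {0..2 * pi} (\<lambda>t. F (cis t))"
    by (intro continuous_on_compose2[OF assms(1)] continuous_intros) auto
  have contH: "continuous_on {0..2 * pi} H"
    unfolding H_def using ne by (intro continuous_intros) auto
  have H: "H t = 2 * (cis t / (cis t - z)) - 1" for t
    using ne[of t] by (simp add: H_def field_simps)
  have i1: "integrable circ (\<lambda>t. F (cis t) * (cis t / (cis t - z)))"
    using ne by (intro integrable_circ_continuous continuous_intros contF) auto
  have i2: "integrable circ (\<lambda>t. F (cis t))"
    by (intro integrable_circ_continuous contF)
  have "integral\<^sup>L circ (\<lambda>t. H t * F (cis t))
      = integral\<^sup>L circ (\<lambda>t. 2 * (F (cis t) * (cis t / (cis t - z))) - F (cis t))"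
    by (simp add: H algebra_simps)
  also have "\<dots> = 2 * (2 * pi * F z) - 2 * pi * F 0"
    by (subst Bochner_Integration.integral_diff[OF integrable_mult_right[OF i1] i2],
        subst integral_mult_right_zero)
       (simp only: Cauchy_integral_circ[OF assms] mean_value_circ[OF assms(1,2)])
  finally have 1: "integral\<^sup>L circ (\<lambda>t. H t * F (cis t)) = 2 * (2 * pi * F z) - 2 * pi * F 0" .
  \<comment> \<open>On the circle conjugation is inversion, which turns the conjugate kernel into a
    fraction whose denominator has no zero in the closed disc.\<close>
  define K where "K = (\<lambda>u. (1 + cnj z * u) / (1 - cnj z * u) * F u)"
  have nz: "1 - cnj z * u \<noteq> 0" if "norm u \<le> 1" for u
  proof
    assume "1 - cnj z * u = 0"
    then have "norm (cnj z * u) = 1" by simp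
    moreover have "norm (cnj z * u) \<le> norm z * 1"
      unfolding norm_mult complex_mod_cnj using that by (intro mult_left_mono) auto
    ultimately show False using assms(3) by simp
  qed
  have K: "cnj (H t) * F (cis t) = K (cis t)" for t
  proof -
    have "cnj (H t) = (cis (-t) + cnj z) / (cis (-t) - cnj z)" by (simp add: H_def cis_cnj)
    also have "\<dots> = (cis t * (cis (-t) + cnj z)) / (cis t * (cis (-t) - cnj z))" by simp
    also have "\<dots> = (1 + cnj z * cis t) / (1 - cnj z * cis t)"
      by (simp add: ring_distribs cis_mult mult_ac)
    finally show ?thesis by (simp add: K_def)
  qed
  have "integral\<^sup>L circ (\<lambda>t. K (cis t)) = 2 * pi * K 0"
  proof (rule mean_value_circ)
    show "continuous_on (cball 0 1) K"
      unfolding K_def using nz by (intro continuous_intros assms(1)) auto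
    show "K holomorphic_on ball 0 1"
      unfolding K_def using nz by (intro holomorphic_intros assms(2)) auto
  qed
  then have "integral\<^sup>L circ (\<lambda>t. cnj (H t) * F (cis t)) = 2 * pi * F 0"
    by (simp add: K) (simp add: K_def)
  from arg_cong[OF this, of cnj]
  have 2: "integral\<^sup>L circ (\<lambda>t. H t * cnj (F (cis t))) = 2 * pi * cnj (F 0)"
    by (simp flip: Bochner_Integration.integral_cnj)
  have "integral\<^sup>L circ (\<lambda>t. H t * of_real (Re (F (cis t))))
      = integral\<^sup>L circ (\<lambda>t. (H t * F (cis t) + H t * cnj (F (cis t))) / 2)"
    by (intro Bochner_Integration.integral_cong) (auto simp: algebra_simps complex_eq_iff)
  also have "\<dots> = (2 * (2 * pi * F z) - 2 * pi * F 0 + 2 * pi * cnj (F 0)) / 2"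
    by (subst integral_divide_zero, subst Bochner_Integration.integral_add)
       (auto simp: 1 2 intro!: integrable_circ_continuous continuous_intros contF contH)
  also have "(1 / (2 * pi)) * \<dots> = F z - (F 0 - cnj (F 0)) / 2"
    by (simp add: field_simps)
  also have "(F 0 - cnj (F 0)) / 2 = \<i> * Im (F 0)" by (simp add: complex_eq_iff)
  finally show ?thesis by (simp add: H_def)
qed

section \<open>Parseval's identity on the circle\<close>

lemma integral_norm_sq_circ_sum:
  fixes y :: "nat \<Rightarrow> complex"
  shows "integral\<^sup>L circ (\<lambda>t. (norm (\<Sum>n<N. y n * cis t ^ n))\<^sup>2) = 2 * pi * (\<Sum>n<N. (norm (y n))\<^sup>2)"
proof (induction N)
  case (Suc N)
  define S where "S = (\<lambda>t. \<Sum>n<N. y n * cis t ^ n)"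
  \<comment> \<open>The cross term with the new summand is the real part of a polynomial on the
    circle; all its exponents \<open>N - n\<close> are positive, so its mean vanishes.\<close>
  define K where "K = (\<lambda>z. y N * (\<Sum>n<N. cnj (y n) * z ^ (N - n)))"
  have cis: "cnj (cis t) ^ n * cis t ^ N = cis t ^ (N - n)" if "n < N" for n t
  proof -
    have "cnj (cis t) ^ n * cis t ^ N = (cnj (cis t) * cis t) ^ n * cis t ^ (N - n)"
      using that by (simp add: power_mult_distrib mult.assoc flip: power_add)
    also have "cnj (cis t) * cis t = 1" by (simp add: cis_cnj cis_mult)
    finally show ?thesis by simp
  qed
  have K: "K (cis t) = cnj (S t) * (y N * cis t ^ N)" for t
    unfolding K_def S_def cnj_sum sum_distrib_right sum_distrib_left
    by (rule sum.cong) (auto simp: mult_ac cis[symmetric])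
  have "norm (S t + y N * cis t ^ N) ^ 2
      = (norm (S t))\<^sup>2 + (norm (y N))\<^sup>2 + 2 * Re (K (cis t))" for t
  proof -
    have "(norm (u + w))\<^sup>2 = (norm u)\<^sup>2 + (norm w)\<^sup>2 + 2 * Re (cnj u * w)" for u w :: complex
      unfolding cmod_power2 by (simp add: power2_eq_square algebra_simps)
    then show ?thesis by (simp add: K norm_mult norm_power)
  qed
  then have "integral\<^sup>L circ (\<lambda>t. (norm (\<Sum>n<Suc N. y n * cis t ^ n))\<^sup>2)
      = integral\<^sup>L circ (\<lambda>t. (norm (S t))\<^sup>2 + (norm (y N))\<^sup>2 + 2 * Re (K (cis t)))"
    by (simp add: S_def)
  also have "\<dots> = integral\<^sup>L circ (\<lambda>t. (norm (S t))\<^sup>2) + 2 * pi * (norm (y N))\<^sup>2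
      + 2 * integral\<^sup>L circ (\<lambda>t. Re (K (cis t)))"
  proof -
    have "integrable circ (\<lambda>t. (norm (S t))\<^sup>2)" "integrable circ (\<lambda>t. Re (K (cis t)))"
      by (auto intro!: integrable_circ_continuous continuous_intros simp: S_def K_def)
    then show ?thesis by simp
  qed
  also have "integral\<^sup>L circ (\<lambda>t. Re (K (cis t))) = 2 * pi * Re (K 0)"
    by (rule mean_value_Re_circ) (auto simp: K_def intro!: continuous_intros holomorphic_intros)
  also have "K 0 = 0"
    unfolding K_def by (subst sum.neutral) auto
  finally show ?case by (simp add: Suc S_def algebra_simps)
qed simp

text \<open>Absolute summability bounds all partial sums uniformly, so the polynomial case passes to
  the limit by dominated convergence.\<close>

lemma integral_norm_sq_circ_suminf:
  fixes y :: ell2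
  assumes "summable (\<lambda>n. norm (nth_ell2 y n))"
  shows "integral\<^sup>L circ (\<lambda>t. (norm (\<Sum>n. nth_ell2 y n * cis t ^ n))\<^sup>2) = 2 * pi * (norm y)\<^sup>2"
proof -
  define B where "B = (\<Sum>n. norm (nth_ell2 y n))"
  have summ: "summable (\<lambda>n. nth_ell2 y n * cis t ^ n)" for t
    by (rule summable_norm_cancel) (simp add: norm_mult norm_power assms)
  have bound: "norm (\<Sum>n<N. nth_ell2 y n * cis t ^ n) \<le> B" for N t
  proof -
    have "norm (\<Sum>n<N. nth_ell2 y n * cis t ^ n) \<le> (\<Sum>n<N. norm (nth_ell2 y n))"
      by (rule sum_norm_le) (simp add: norm_mult norm_power)
    also have "\<dots> \<le> B" unfolding B_def by (rule sum_le_suminf[OF assms]) auto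
    finally show ?thesis .
  qed
  have meas: "(\<lambda>t. (norm (\<Sum>n<N. nth_ell2 y n * cis t ^ n))\<^sup>2) \<in> borel_measurable circ" for N
    by (rule borel_measurable_integrable) (intro integrable_circ_continuous continuous_intros)
  have lim: "(\<lambda>N. (norm (\<Sum>n<N. nth_ell2 y n * cis t ^ n))\<^sup>2)
      \<longlonglongrightarrow> (norm (\<Sum>n. nth_ell2 y n * cis t ^ n))\<^sup>2" for t
    by (intro tendsto_intros summable_LIMSEQ summ)
  have "(\<lambda>N. integral\<^sup>L circ (\<lambda>t. (norm (\<Sum>n<N. nth_ell2 y n * cis t ^ n))\<^sup>2))
      \<longlonglongrightarrow> integral\<^sup>L circ (\<lambda>t. (norm (\<Sum>n. nth_ell2 y n * cis t ^ n))\<^sup>2)"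
  proof (rule integral_dominated_convergence)
    show "integrable circ (\<lambda>t. B\<^sup>2)" by simp
    show "(\<lambda>t. (norm (\<Sum>n. nth_ell2 y n * cis t ^ n))\<^sup>2) \<in> borel_measurable circ"
      using meas lim by (rule borel_measurable_LIMSEQ_real[rotated])
    show "AE t in circ. norm ((norm (\<Sum>n<N. nth_ell2 y n * cis t ^ n))\<^sup>2) \<le> B\<^sup>2" for N
      by (auto intro!: AE_I2 power_mono bound)
  qed (use meas lim in auto)
  moreover have "(\<lambda>N. 2 * pi * (\<Sum>n<N. (norm (nth_ell2 y n))\<^sup>2)) \<longlonglongrightarrow> 2 * pi * (norm y)\<^sup>2"
    unfolding norm_ell2_sq by (intro tendsto_intros summable_LIMSEQ summable_nth_sq)
  ultimately show ?thesis
    unfolding integral_norm_sq_circ_sum by (rule LIMSEQ_unique)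
qed

text \<open>Roots inside the disc are reflected across the circle, all others are pushed slightly outwards.\<close>

lemma zero_free_majorant:
  fixes p :: "complex poly"
  assumes "p \<noteq> 0" "\<epsilon> > 0"
  shows "\<exists>L. continuous_on (cball 0 1) L \<and> L holomorphic_on ball 0 1 \<and>
    norm (poly p 0) \<le> exp (Re (L 0)) \<and>
    (\<forall>z. norm z = 1 \<longrightarrow> exp (Re (L z)) \<le> norm (poly p z) + \<epsilon>)"
  using assms
proof (induction "degree p" arbitrary: p \<epsilon>)
  case 0
  then obtain c where c: "p = [:c:]" "c \<noteq> 0" by (metis degree_0_id pCons_0_0 of_nat_0 degree_eq_zeroE)
  then show ?case using 0 by (intro exI[of _ "\<lambda>_. Ln c"]) (auto simp: norm_exp_eq_Re[symmetric])
next
  case (Suc n)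
  have "degree p \<noteq> 0" using Suc.hyps(2) by simp
  then obtain w where "poly p w = 0"
    using alg_closed_imp_poly_has_root[of p] by auto
  then obtain q where q: "p = [:- w, 1:] * q" by (auto simp: poly_eq_0_iff_dvd elim: dvdE)
  have q0: "q \<noteq> 0" using q Suc.prems by auto
  have "degree p = Suc (degree q)" unfolding q using q0 by (subst degree_mult_eq) auto
  then have deg: "n = degree q" using Suc.hyps by simp
  have "bounded (poly q ` cball 0 1)"
    by (intro compact_imp_bounded compact_continuous_image continuous_intros) auto
  then obtain B where B: "B > 0" "\<And>z. norm z \<le> 1 \<Longrightarrow> norm (poly q z) \<le> B"
    unfolding bounded_pos by auto
  \<comment> \<open>\<open>W\<close> bounds \<open>norm (z - w) + \<delta>\<close> on the circle;
    \<open>\<epsilon>'\<close> and \<open>\<delta>\<close> are scaled so that each of the two error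
    terms at the end is at most \<open>\<epsilon> / 2\<close>.\<close>
  define W where "W = norm w + 2"
  define \<epsilon>' where "\<epsilon>' = \<epsilon> / (2 * W)"
  define \<delta> where "\<delta> = min 1 (\<epsilon> / (2 * B))"
  have W: "W > 0" by (simp add: W_def add_nonneg_pos)
  have \<epsilon>': "\<epsilon>' > 0" and \<delta>: "\<delta> > 0" using W B Suc.prems by (auto simp: \<epsilon>'_def \<delta>_def)
  obtain L where L: "continuous_on (cball 0 1) L" "L holomorphic_on ball 0 1"
    "norm (poly q 0) \<le> exp (Re (L 0))"
    "\<And>z. norm z = 1 \<Longrightarrow> exp (Re (L z)) \<le> norm (poly q z) + \<epsilon>'"
    using Suc.hyps(1)[OF deg q0 \<epsilon>'] by blast
  \<comment> \<open>The factor \<open>z - w\<close> is replaced by \<open>K * (1 - v * z)\<close>,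
    which has no zero in the closed disc, is at least as large at the origin and exceeds it in
    modulus by at most \<open>\<delta>\<close> on the circle.\<close>
  have "\<exists>K v. K \<noteq> 0 \<and> norm v < 1 \<and> norm w \<le> norm K \<and>
      (\<forall>z. norm z = 1 \<longrightarrow> norm (K * (1 - v * z)) \<le> norm (z - w) + \<delta>)"
  proof (cases "norm w < 1")
    case True
    have "norm (1 - cnj w * z) \<le> norm (z - w) + \<delta>" if "norm z = 1" for z
    proof -
      have "norm (1 - cnj w * z) = norm (cnj z * (z - w))"
        using that complex_norm_square[of z]
        by (subst complex_mod_cnj[symmetric]) (simp add: algebra_simps)
      then show ?thesis using that \<delta> by (simp add: norm_mult)
    qed
    with True show ?thesis by (intro exI[of _ 1] exI[of _ "cnj w"]) auto
  next
    case False
    then have nw: "norm w \<ge> 1" by simp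
    define w' where "w' = (1 + \<delta> / norm w) *\<^sub>R w"
    have "0 < 1 + \<delta> / norm w" using nw \<delta> by (intro add_pos_nonneg) auto
    then have "norm w' = (1 + \<delta> / norm w) * norm w" unfolding w'_def norm_scaleR by simp
    also have "\<dots> = norm w + \<delta>" using nw by (auto simp: field_simps)
    finally have w': "norm w' = norm w + \<delta>" .
    have "w' - w = (\<delta> / norm w) *\<^sub>R w" by (simp add: w'_def scaleR_add_left)
    moreover have "norm ((\<delta> / norm w) *\<^sub>R w) = \<delta>" using nw \<delta> by auto
    ultimately have "norm (w' - w) = \<delta>" by simp
    then have "norm (z - w') \<le> norm (z - w) + \<delta>" for z
      using norm_triangle_ineq4[of "z - w" "w' - w"] by simp
    moreover have "- w' * (1 - 1 / w' * z) = z - w'" for z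
      using w' nw \<delta> by (auto simp: algebra_simps)
    ultimately show ?thesis
      using w' nw \<delta> by (intro exI[of _ "- w'"] exI[of _ "1 / w'"]) (auto simp: norm_divide)
  qed
  then obtain K v where K: "K \<noteq> 0" "norm v < 1" "norm w \<le> norm K"
    "\<And>z. norm z = 1 \<Longrightarrow> norm (K * (1 - v * z)) \<le> norm (z - w) + \<delta>" by blast
  \<comment> \<open>A positive real part keeps \<open>1 - v * z\<close> off the branch cut of
    \<open>Ln\<close>.\<close>
  have Re_pos: "Re (1 - v * z) > 0" if "norm z \<le> 1" for z
  proof -
    have "Re (v * z) \<le> norm v * norm z" using complex_Re_le_cmod[of "v * z"] by (simp add: norm_mult)
    also have "\<dots> \<le> norm v * 1" using that by (intro mult_left_mono) auto
    finally show ?thesis using K(2) by simp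
  qed
  have nonpos: "1 - v * z \<notin> \<real>\<^sub>\<le>\<^sub>0" "1 - v * z \<noteq> 0" if "norm z \<le> 1" for z
  proof -
    show "1 - v * z \<notin> \<real>\<^sub>\<le>\<^sub>0" using Re_pos[OF that] by (auto simp: complex_nonpos_Reals_iff)
    then show "1 - v * z \<noteq> 0" using nonpos_Reals_zero_I by metis
  qed
  define L' where "L' = (\<lambda>z. L z + (Ln K + Ln (1 - v * z)))"
  have exp_L': "exp (Re (L' z)) = exp (Re (L z)) * norm (K * (1 - v * z))" if "norm z \<le> 1" for z
    using K(1) nonpos(2)[OF that] by (simp add: L'_def exp_add norm_mult flip: norm_exp_eq_Re)
  show ?case
  proof (intro exI[of _ L'] conjI allI impI)
    show "continuous_on (cball 0 1) L'"
      unfolding L'_def using nonpos by (intro continuous_intros L(1)) auto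
    show "L' holomorphic_on ball 0 1"
      unfolding L'_def using nonpos by (intro holomorphic_intros L(2)) auto
    have "norm (poly p 0) = norm (poly q 0) * norm w" by (simp add: q norm_mult)
    also have "\<dots> \<le> exp (Re (L 0)) * norm K" using L(3) K(3) by (intro mult_mono) auto
    finally show "norm (poly p 0) \<le> exp (Re (L' 0))" by (simp add: exp_L')
    fix z :: complex assume z: "norm z = 1"
    have zw: "norm (z - w) + \<delta> \<le> W"
      using norm_triangle_ineq4[of z w] z by (simp add: W_def \<delta>_def)
    have "exp (Re (L' z)) \<le> (norm (poly q z) + \<epsilon>') * (norm (z - w) + \<delta>)"
      using z L(4)[OF z] K(4)[OF z] \<epsilon>' by (simp only: exp_L' order_refl, intro mult_mono) auto
    also have "\<dots> = norm (poly q z * (z - w)) + norm (poly q z) * \<delta> + \<epsilon>' * (norm (z - w) + \<delta>)"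
      unfolding norm_mult by (simp only: distrib_left distrib_right add_ac)
    also have "poly q z * (z - w) = poly p z" by (simp add: q algebra_simps)
    also have "norm (poly p z) + norm (poly q z) * \<delta> + \<epsilon>' * (norm (z - w) + \<delta>)
        \<le> norm (poly p z) + B * (\<epsilon> / (2 * B)) + \<epsilon>' * W"
      using zw B z \<epsilon>' \<delta> Suc.prems by (intro add_mono mult_mono) (auto simp: \<delta>_def)
    also have "\<dots> = norm (poly p z) + \<epsilon>" using B W by (simp add: \<epsilon>'_def)
    finally show "exp (Re (L' z)) \<le> norm (poly p z) + \<epsilon>" .
  qed
qed

section \<open>Cyclic contractive multipliers are outer\<close>

definition rad :: "nat \<Rightarrow> real" where "rad i = 1 - 1 / (real i + 2)"

lemma rad_bounds: "0 < rad i" "rad i < 1"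
  by (auto simp: rad_def field_simps)

lemma rad_tendsto: "rad \<longlonglongrightarrow> 1"
  unfolding rad_def by real_asymp

text \<open>The coefficients of the function whose boundary values are the values of
  \<open>hfun x\<close> on the circle of radius \<open>rad i\<close>.\<close>

lift_definition dilate :: "nat \<Rightarrow> ell2 \<Rightarrow> ell2" is "\<lambda>i x n. x n * of_real (rad i) ^ n"
proof -
  fix i and x :: "nat \<Rightarrow> complex"
  assume "summable (\<lambda>n. (norm (x n))\<^sup>2)"
  then show "summable (\<lambda>n. (norm (x n * of_real (rad i) ^ n))\<^sup>2)"
  proof (rule summable_comparison_test')
    fix n
    have "norm (x n) * rad i ^ n \<le> norm (x n) * 1"
      using rad_bounds[of i] by (intro mult_left_mono power_le_one) auto
    then show "norm ((norm (x n * of_real (rad i) ^ n))\<^sup>2) \<le> (norm (x n))\<^sup>2"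
      using rad_bounds[of i] by (auto simp: norm_mult norm_power intro!: power_mono)
  qed
qed

lemma nth_dilate [simp]: "nth_ell2 (dilate i x) n = nth_ell2 x n * of_real (rad i) ^ n"
  by (simp add: dilate.rep_eq)

lemma summable_nth_dilate: "summable (\<lambda>n. norm (nth_ell2 (dilate i x) n))"
  using summable_norm_hfun[of "of_real (rad i)" x] rad_bounds[of i] by simp

lemma norm_rad_cis: "norm (of_real (rad i) * cis t) = rad i"
  using rad_bounds[of i] by (simp add: norm_mult)

lemma hfun_rad_cis: "hfun x (of_real (rad i) * cis t) = (\<Sum>n. nth_ell2 (dilate i x) n * cis t ^ n)"
proof -
  have "of_real (rad i) * cis t \<in> disc" using norm_rad_cis[of i t] rad_bounds[of i] by simp
  then show ?thesis
    unfolding hfun_def nth_dilate power_mult_distrib by (simp only: if_True mult.assoc)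
qed

lemma norm_dilate_le: "norm (dilate i x) \<le> norm x"
proof (rule power2_le_imp_le)
  have "norm (nth_ell2 x n) * rad i ^ n \<le> norm (nth_ell2 x n) * 1" for n
    using rad_bounds[of i] by (intro mult_left_mono power_le_one) auto
  then show "(norm (dilate i x))\<^sup>2 \<le> (norm x)\<^sup>2"
    unfolding norm_ell2_sq using rad_bounds[of i]
    by (intro suminf_le summable_nth_sq) (auto simp: norm_mult norm_power intro!: power_mono)
qed simp

text \<open>Tannery's theorem, dominated by the squared norms of the coefficients of
  \<open>x\<close>, because \<open>rad i ^ n - 1\<close> has modulus at most 1.\<close>

lemma dilate_tendsto: "(\<lambda>i. dilate i x) \<longlonglongrightarrow> x"
proof -
  have "(\<lambda>i. \<Sum>n. (norm (nth_ell2 (dilate i x - x) n))\<^sup>2) \<longlonglongrightarrow> (\<Sum>n. 0)"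
  proof (rule tannerys_theorem[THEN conjunct2, THEN conjunct2])
    show "(\<lambda>i. (norm (nth_ell2 (dilate i x - x) n))\<^sup>2) \<longlonglongrightarrow> 0" for n
    proof -
      have "(\<lambda>i. (norm (nth_ell2 x n * of_real (rad i) ^ n - nth_ell2 x n))\<^sup>2)
          \<longlonglongrightarrow> (norm (nth_ell2 x n * of_real 1 ^ n - nth_ell2 x n))\<^sup>2"
        by (intro tendsto_intros rad_tendsto)
      then show ?thesis by simp
    qed
    have "norm (nth_ell2 (dilate i x - x) n) \<le> norm (nth_ell2 x n)" for i n
    proof -
      have "nth_ell2 (dilate i x - x) n = nth_ell2 x n * of_real (rad i ^ n - 1)"
        by (simp add: algebra_simps)
      moreover have "\<bar>rad i ^ n - 1\<bar> \<le> 1"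
        using rad_bounds[of i] power_le_one[of "rad i" n] zero_le_power[of "rad i" n]
        by (simp add: abs_if)
      ultimately show ?thesis
        using mult_left_le[of "\<bar>rad i ^ n - 1\<bar>" "norm (nth_ell2 x n)"]
        by (simp only: norm_mult norm_of_real) simp
    qed
    then show "\<forall>\<^sub>F (n, i) in at_top \<times>\<^sub>F sequentially.
        norm ((norm (nth_ell2 (dilate i x - x) n))\<^sup>2) \<le> (norm (nth_ell2 x n))\<^sup>2"
      by (intro always_eventually) (auto intro!: power_mono)
  qed (auto intro: summable_nth_sq)
  then have "(\<lambda>i. (norm (dilate i x - x))\<^sup>2) \<longlonglongrightarrow> 0" by (simp add: norm_ell2_sq)
  from tendsto_real_sqrt[OF this] have "(\<lambda>i. norm (dilate i x - x)) \<longlonglongrightarrow> 0" by simp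
  then show ?thesis by (rule LIM_zero_cancel[OF tendsto_norm_zero_cancel])
qed

lemma continuous_on_hfun_rad: "continuous_on S (\<lambda>t. hfun x (of_real (rad i) * cis t))"
  using rad_bounds[of i]
  by (intro continuous_on_compose2[OF holomorphic_on_imp_continuous_on[OF hfun_holomorphic[of x]]]
      continuous_intros) (auto simp: norm_mult)

lemma integral_hfun_rad_le:
  "integral\<^sup>L circ (\<lambda>t. (norm (hfun x (of_real (rad i) * cis t)))\<^sup>2) \<le> 2 * pi * (norm x)\<^sup>2"
  unfolding hfun_rad_cis integral_norm_sq_circ_suminf[OF summable_nth_dilate]
  using norm_dilate_le[of i x] by (intro mult_left_mono power_mono) auto

lemma integral_hfun_rad_diff:
  "integral\<^sup>L circ (\<lambda>t. (norm (hfun x (of_real (rad i) * cis t) - hfun x (of_real (rad j) * cis t)))\<^sup>2)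
    = 2 * pi * (norm (dilate i x - dilate j x))\<^sup>2"
proof -
  have s: "summable (\<lambda>n. nth_ell2 (dilate i x) n * cis t ^ n)" for i t
    by (rule summable_norm_cancel) (use summable_nth_dilate[of i x] in \<open>simp add: norm_mult norm_power\<close>)
  have "summable (\<lambda>n. norm (nth_ell2 (dilate i x - dilate j x) n))"
    by (rule summable_comparison_test'[OF summable_add[OF summable_nth_dilate[of i x] summable_nth_dilate[of j x]]])
       (simp only: nth_ell2_simps real_norm_def abs_norm_cancel norm_triangle_ineq4)
  from integral_norm_sq_circ_suminf[OF this] show ?thesis
    unfolding hfun_rad_cis by (simp add: suminf_diff[OF s s] left_diff_distrib del: nth_dilate)
qed

text \<open>By Parseval the restrictions of \<open>hfun x\<close> to the circles are Cauchy in mean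
  square, hence in \<open>L^1\<close>, and some subsequence of an \<open>L^1\<close> Cauchy sequence
  converges almost everywhere. This takes the place of Fatou's theorem on radial limits.\<close>

lemma radial_limit_subsequence:
  obtains \<sigma> A where "strict_mono \<sigma>" "A \<in> borel_measurable circ"
    "AE t in circ. (\<lambda>k. hfun x (of_real (rad (\<sigma> k)) * cis t)) \<longlonglongrightarrow> A t"
proof -
  define s where "s = (\<lambda>i t. hfun x (of_real (rad i) * cis t))"
  have int: "integrable circ (s i)" for i
    unfolding s_def by (intro integrable_circ_continuous continuous_on_hfun_rad)
  have intd: "integrable circ (\<lambda>t. (norm (s i t - s j t))\<^sup>2)" for i j
    unfolding s_def by (intro integrable_circ_continuous continuous_intros continuous_on_hfun_rad)
  have cauchy: "\<exists>N. \<forall>i\<ge>N. \<forall>j\<ge>N. (LINT t|circ. norm (s i t - s j t)) < e" if "e > 0" for e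
  proof -
    \<comment> \<open>The estimates below add up to \<open>4 * pi * \<eta>\<close>, which is half of
      \<open>e\<close>.\<close>
    define \<eta> where "\<eta> = e / (8 * pi)"
    have \<eta>: "\<eta> > 0" using that by (simp add: \<eta>_def)
    obtain N where N: "\<And>i j. i \<ge> N \<Longrightarrow> j \<ge> N \<Longrightarrow> norm (dilate i x - dilate j x) < \<eta>"
      using CauchyD[OF LIMSEQ_imp_Cauchy[OF dilate_tendsto[of x]] \<eta>] by blast
    have "(LINT t|circ. norm (s i t - s j t)) < e" if "i \<ge> N" "j \<ge> N" for i j
    proof -
      \<comment> \<open>Splitting at the level \<eta> bounds the \<open>L^1\<close> distance by the
        mean square without the Cauchy-Schwarz inequality for integrals.\<close>
      have "norm (s i t - s j t) \<le> \<eta> + (norm (s i t - s j t))\<^sup>2 / \<eta>" for t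
      proof (cases "norm (s i t - s j t) \<le> \<eta>")
        case True
        then show ?thesis using \<eta> by (simp add: add_increasing2)
      next
        case False
        then have "norm (s i t - s j t) * \<eta> \<le> norm (s i t - s j t) * norm (s i t - s j t)"
          by (intro mult_left_mono) auto
        then have "norm (s i t - s j t) \<le> (norm (s i t - s j t))\<^sup>2 / \<eta>"
          using \<eta> by (simp add: field_simps power2_eq_square)
        then show ?thesis using \<eta> by simp
      qed
      then have "(LINT t|circ. norm (s i t - s j t)) \<le> (LINT t|circ. \<eta> + (norm (s i t - s j t))\<^sup>2 / \<eta>)"
        using int intd by (intro integral_mono) auto
      also have "\<dots> = 2 * pi * \<eta> + (LINT t|circ. (norm (s i t - s j t))\<^sup>2) / \<eta>"
        using intd by simp
      also have "\<dots> = 2 * pi * \<eta> + 2 * pi * (norm (dilate i x - dilate j x))\<^sup>2 / \<eta>"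
        unfolding s_def integral_hfun_rad_diff ..
      also have "\<dots> \<le> 2 * pi * \<eta> + 2 * pi * \<eta>\<^sup>2 / \<eta>"
        using \<eta> N[OF that] by (intro add_left_mono divide_right_mono mult_left_mono power_mono) auto
      also have "\<dots> < e" using \<open>e > 0\<close> \<eta> by (simp add: power2_eq_square) (simp add: \<eta>_def)
      finally show ?thesis .
    qed
    then show ?thesis by blast
  qed
  obtain \<sigma> where \<sigma>: "strict_mono \<sigma>" "AE t in circ. Cauchy (\<lambda>k. s (\<sigma> k) t)"
    by (rule cauchy_L1_AE_cauchy_subseq[of circ s, OF int cauchy])
  show ?thesis
  proof (rule that[of \<sigma> "\<lambda>t. lim (\<lambda>k. s (\<sigma> k) t)"])
    show "(\<lambda>t. lim (\<lambda>k. s (\<sigma> k) t)) \<in> borel_measurable circ"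
      by (intro borel_measurable_lim_metric borel_measurable_integrable int)
    show "AE t in circ. (\<lambda>k. hfun x (of_real (rad (\<sigma> k)) * cis t)) \<longlonglongrightarrow> lim (\<lambda>k. s (\<sigma> k) t)"
      using \<sigma>(2) by eventually_elim (simp add: Cauchy_convergent_iff convergent_LIMSEQ_iff s_def)
  qed (rule \<sigma>)
qed

section \<open>From cyclicity to the outer representation\<close>

locale cyclic_multiplier =
  fixes x :: ell2
  assumes bound: "norm z < 1 \<Longrightarrow> norm (hfun x z) \<le> 1"
    and contractive: "\<exists>d. norm d \<le> norm c \<and> (\<forall>z. hfun d z = hfun c z * hfun x z)"
    and cyclic: "\<epsilon> > 0 \<Longrightarrow> \<exists>c d. norm (d - unit0) < \<epsilon> \<and> (\<forall>z. hfun d z = hfun c z * hfun x z)"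
begin

text \<open>Evaluation at \<open>z\<close> is continuous, so a zero at \<open>z\<close> would be
  shared by all limits of multiples, yet multiples come arbitrarily close to 1. The tolerance
  \<open>1 - norm z\<close> offsets the factor in \<open>norm_hfun_le\<close>.\<close>

lemma nonzero:
  assumes "norm z < 1"
  shows "hfun x z \<noteq> 0"
proof
  assume "hfun x z = 0"
  obtain c d where d: "norm (d - unit0) < 1 - norm z" "\<And>z. hfun d z = hfun c z * hfun x z"
    using cyclic[of "1 - norm z"] assms by auto
  have "norm (hfun (d - unit0) z) \<le> norm (d - unit0) / (1 - norm z)"
    by (rule norm_hfun_le[OF assms])
  also have "\<dots> < 1" using d(1) assms by simp
  finally show False using \<open>hfun x z = 0\<close> assms by (simp add: hfun_diff d(2) hfun_unit0)
qed

text \<open>Truncating \<open>c\<close> changes the product by the product with a tail, and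
  \<open>contractive\<close> bounds that by the norm of the tail.\<close>

lemma polynomial_approximation:
  assumes "\<epsilon> > 0"
  obtains p :: "complex poly" and d where "norm (d - unit0) < \<epsilon>"
    "\<And>z. norm z < 1 \<Longrightarrow> hfun d z = poly p z * hfun x z"
proof -
  obtain c d where cd: "norm (d - unit0) < \<epsilon> / 2" "\<And>z. hfun d z = hfun c z * hfun x z"
    using cyclic[of "\<epsilon> / 2"] assms by auto
  obtain N where N: "norm (trunc N c - c) < \<epsilon> / 2"
    using LIMSEQ_D[OF trunc_tendsto[of c], of "\<epsilon> / 2"] assms by auto
  obtain h where h: "norm h \<le> norm (trunc N c - c)" "\<And>z. hfun h z = hfun (trunc N c - c) z * hfun x z"
    using contractive by blast
  define p where "p = (\<Sum>n<N. monom (nth_ell2 c n) n)"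
  have p: "hfun (trunc N c) z = poly p z" if "norm z < 1" for z
  proof -
    have "(\<Sum>n. nth_ell2 (trunc N c) n * z ^ n) = (\<Sum>n<N. nth_ell2 (trunc N c) n * z ^ n)"
      by (rule suminf_finite) auto
    also have "\<dots> = poly p z" by (simp add: p_def poly_sum poly_monom)
    finally show ?thesis using that by (simp add: hfun_def)
  qed
  show ?thesis
  proof (rule that[of "d + h" p])
    have "norm (d + h - unit0) \<le> norm (d - unit0) + norm h"
      using norm_triangle_ineq[of "d - unit0" h] by (simp add: algebra_simps)
    then show "norm (d + h - unit0) < \<epsilon>" using cd(1) h(1) N by linarith
    show "hfun (d + h) z = poly p z * hfun x z" if "norm z < 1" for z
      by (simp add: hfun_add cd h hfun_diff p[OF that] algebra_simps)
  qed
qed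

theorem outer_hfun: "outer (hfun x)"
proof -
  \<comment> \<open>A zero-free holomorphic function on the disc has a holomorphic
    logarithm.\<close>
  obtain g where g: "g holomorphic_on disc" "\<And>z. z \<in> disc \<Longrightarrow> hfun x z = exp (g z)"
    using contractible_imp_holomorphic_log[OF hfun_holomorphic[of x]] nonzero
    by (metis convex_ball convex_imp_contractible mem_ball_0)
  obtain \<sigma> A where \<sigma>: "strict_mono \<sigma>" and A_meas: "A \<in> borel_measurable circ"
    and A_lim: "AE t in circ. (\<lambda>k. hfun x (of_real (rad (\<sigma> k)) * cis t)) \<longlonglongrightarrow> A t"
    using radial_limit_subsequence .
  define \<rho> where "\<rho> = (\<lambda>k. rad (\<sigma> k))"
  have \<rho>: "0 < \<rho> k" "\<rho> k < 1" for k by (simp_all add: \<rho>_def rad_bounds)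
  have \<rho>_lim: "\<rho> \<longlonglongrightarrow> 1"
    unfolding \<rho>_def using LIMSEQ_subseq_LIMSEQ[OF rad_tendsto \<sigma>] by (simp add: o_def)
  define F where "F = (\<lambda>k z. g (of_real (\<rho> k) * z))"
  have in_disc: "of_real (\<rho> k) * z \<in> disc" if "norm z \<le> 1" for k z
  proof -
    have "\<rho> k * norm z \<le> \<rho> k * 1" using \<rho>[of k] that by (intro mult_left_mono) auto
    then have "\<rho> k * norm z < 1" using \<rho>(2)[of k] by linarith
    then show ?thesis using \<rho>(1)[of k] by (simp add: norm_mult)
  qed
  have F_cont: "continuous_on (cball 0 1) (F k)" for k
    unfolding F_def using in_disc
    by (intro continuous_on_compose2[OF holomorphic_on_imp_continuous_on[OF g(1)]] continuous_intros) auto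
  have F_hol: "F k holomorphic_on ball 0 1" for k
    unfolding F_def using in_disc
    by (intro holomorphic_on_compose_gen[OF _ g(1), unfolded o_def] holomorphic_intros) auto
  \<comment> \<open>Minus the logarithm of the modulus on the circle of radius
    \<open>\<rho> k\<close>. It is nonnegative because the multiplier is bounded by 1, and its mean
    \<open>C\<close> is the same for all \<open>k\<close> because the real part of \<open>g\<close>
    is harmonic.\<close>
  define v where "v = (\<lambda>k t. - Re (F k (cis t)))"
  have x_F: "hfun x (of_real (\<rho> k) * cis t) = exp (F k (cis t))" for k t
    unfolding F_def by (rule g(2)) (rule in_disc, simp)
  have v_eq: "v k t = - ln (norm (hfun x (of_real (\<rho> k) * cis t)))" for k t
    by (simp add: x_F v_def)
  have v_nonneg: "0 \<le> v k t" for k t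
    unfolding v_eq using bound[of "of_real (\<rho> k) * cis t"] \<rho>[of k] nonzero[of "of_real (\<rho> k) * cis t"]
    by (simp add: norm_mult)
  have v_int: "integrable circ (v k)" for k
    unfolding v_def using integrable_Re[OF integrable_circ_comp_cis[OF F_cont[of k]]]
    by (intro integrable_minus) auto
  define C where "C = - Re (g 0)"
  have v_mean: "integral\<^sup>L circ (v k) = 2 * pi * C" for k
    unfolding v_def using mean_value_Re_circ[OF F_cont F_hol, of k] by (simp add: C_def F_def)
  have x_0: "norm (hfun x 0) = exp (- C)" by (simp add: g(2) C_def del: hfun_at_0)
  have v_nn: "(\<integral>\<^sup>+ t. ennreal (v k t) \<partial>circ) = ennreal (2 * pi * C)" for k
    using nn_integral_eq_integral[OF v_int, of k] v_nonneg v_mean by simp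

  have fatou: "(\<integral>\<^sup>+ t. liminf (\<lambda>k. ennreal (v k t)) \<partial>circ) \<le> ennreal (2 * pi * C)"
  proof -
    have "(\<integral>\<^sup>+ t. liminf (\<lambda>k. ennreal (v k t)) \<partial>circ) \<le> liminf (\<lambda>k. \<integral>\<^sup>+ t. ennreal (v k t) \<partial>circ)"
      by (rule nn_integral_liminf) (use borel_measurable_integrable[OF v_int] in measurable)
    then show ?thesis by (simp add: v_nn Liminf_const)
  qed
  have liminf_meas: "(\<lambda>t. liminf (\<lambda>k. ennreal (v k t))) \<in> borel_measurable circ"
    using borel_measurable_integrable[OF v_int] by measurable
  \<comment> \<open>Where \<open>A\<close> vanishes, \<open>v k\<close> tends to infinity; Fatou's
    lemma confines this to a null set.\<close>
  have "AE t in circ. liminf (\<lambda>k. ennreal (v k t)) \<noteq> \<infinity>"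
    using fatou by (intro nn_integral_PInf_AE liminf_meas) (auto simp: top_unique)
  with A_lim have A_nz: "AE t in circ. A t \<noteq> 0"
  proof eventually_elim
    case (elim t)
    show ?case
    proof
      assume "A t = 0"
      then have "(\<lambda>k. norm (hfun x (of_real (\<rho> k) * cis t))) \<longlonglongrightarrow> 0"
        using tendsto_norm[OF elim(1)] by (simp add: \<rho>_def)
      moreover have "norm (hfun x (of_real (\<rho> k) * cis t)) > 0" for k by (simp add: x_F)
      ultimately have "filterlim (\<lambda>k. norm (hfun x (of_real (\<rho> k) * cis t))) (at_right 0) sequentially"
        by (auto simp: filterlim_at intro!: always_eventually)
      then have "filterlim (\<lambda>k. ln (norm (hfun x (of_real (\<rho> k) * cis t)))) at_bot sequentially"
        by (rule filterlim_compose[OF ln_at_0])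
      then have "filterlim (\<lambda>k. v k t) at_top sequentially"
        unfolding v_eq by (simp add: filterlim_uminus_at_top)
      then have "(\<lambda>k. ennreal (v k t)) \<longlonglongrightarrow> top"
        by (simp add: ennreal_tendsto_top_eq_at_top)
      from lim_imp_Liminf[OF sequentially_bot this] elim(2) show False by simp
    qed
  qed
  define V where "V = (\<lambda>t. - ln (norm (A t)))"
  have V_meas: "V \<in> borel_measurable circ" unfolding V_def using A_meas by measurable
  have v_lim: "AE t in circ. (\<lambda>k. v k t) \<longlonglongrightarrow> V t"
    using A_lim A_nz
  proof eventually_elim
    case (elim t)
    then show ?case unfolding v_eq V_def \<rho>_def by (intro tendsto_intros) auto
  qed
  then have V_nonneg: "AE t in circ. 0 \<le> V t"
    by eventually_elim (use v_nonneg in \<open>auto intro: LIMSEQ_le_const\<close>)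
  have V_nn_le: "(\<integral>\<^sup>+ t. ennreal (V t) \<partial>circ) \<le> ennreal (2 * pi * C)"
  proof -
    have "AE t in circ. liminf (\<lambda>k. ennreal (v k t)) = ennreal (V t)"
      using v_lim by eventually_elim (intro lim_imp_Liminf tendsto_ennrealI sequentially_bot)
    then have "(\<integral>\<^sup>+ t. ennreal (V t) \<partial>circ) = (\<integral>\<^sup>+ t. liminf (\<lambda>k. ennreal (v k t)) \<partial>circ)"
      by (intro nn_integral_cong_AE) auto
    with fatou show ?thesis by simp
  qed
  have V_int: "integrable circ V"
    using V_nn_le by (intro integrableI_nonneg V_meas V_nonneg) (auto simp: less_top[symmetric] top_unique)

  \<comment> \<open>Szego's inequality: cyclicity gives the bound opposite to Fatou's lemma.\<close>
  have szego: "ln (1 - \<eta>) + C \<le> integral\<^sup>L circ V / (2 * pi) + ln ((1 + \<eta>)\<^sup>2 + \<eta>) / 2"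
    if \<eta>: "0 < \<eta>" "\<eta> < 1" for \<eta>
  proof -
    obtain p :: "complex poly" and d where d: "norm (d - unit0) < \<eta>"
      and p: "\<And>z. norm z < 1 \<Longrightarrow> hfun d z = poly p z * hfun x z"
      using polynomial_approximation[OF \<eta>(1)] by blast
    have "norm (hfun d 0 - 1) < \<eta>"
      using norm_nth_le[of "d - unit0" 0] d by simp
    then have d0: "1 - \<eta> \<le> norm (hfun d 0)"
      using norm_triangle_ineq2[of 1 "hfun d 0"] by (simp add: norm_minus_commute)
    also have "\<dots> = norm (poly p 0) * exp (- C)" using p[of 0] x_0 by (simp add: norm_mult del: hfun_at_0)
    finally have p0: "1 - \<eta> \<le> norm (poly p 0) * exp (- C)" .
    then have p_nz: "p \<noteq> 0" using \<eta> by auto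
    have "bounded (poly p ` cball 0 1)"
      by (intro compact_imp_bounded compact_continuous_image continuous_intros) auto
    then obtain P where P: "P > 0" "\<And>z. norm z \<le> 1 \<Longrightarrow> norm (poly p z) \<le> P"
      unfolding bounded_pos by auto
    \<comment> \<open>Small enough that passing from the modulus of \<open>p\<close> to its
      zero-free majorant raises the square on the circle by at most \<open>\<eta>\<close>.\<close>
    define \<epsilon> where "\<epsilon> = min 1 (\<eta> / (2 * P + 1))"
    have \<epsilon>: "\<epsilon> > 0" using \<eta> P by (simp add: \<epsilon>_def)
    have \<epsilon>_le: "2 * P * \<epsilon> + \<epsilon>\<^sup>2 \<le> \<eta>"
    proof -
      have "\<epsilon>\<^sup>2 \<le> \<epsilon> * 1" unfolding power2_eq_square using \<epsilon> by (intro mult_left_mono) (auto simp: \<epsilon>_def)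
      then have "2 * P * \<epsilon> + \<epsilon>\<^sup>2 \<le> (2 * P + 1) * \<epsilon>" by (simp add: algebra_simps)
      also have "\<dots> \<le> (2 * P + 1) * (\<eta> / (2 * P + 1))"
        using P by (intro mult_left_mono) (auto simp: \<epsilon>_def)
      finally show ?thesis using P by simp
    qed
    obtain L where L_cont: "continuous_on (cball 0 1) L" and L_hol: "L holomorphic_on ball 0 1"
      and L0: "norm (poly p 0) \<le> exp (Re (L 0))"
      and L1: "\<And>z. norm z = 1 \<Longrightarrow> exp (Re (L z)) \<le> norm (poly p z) + \<epsilon>"
      using zero_free_majorant[OF p_nz \<epsilon>] by blast
    have L_sq: "(exp (Re (L (cis t))))\<^sup>2 \<le> (norm (poly p (cis t)))\<^sup>2 + \<eta>" for t
    proof -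
      have "(exp (Re (L (cis t))))\<^sup>2 \<le> (norm (poly p (cis t)) + \<epsilon>)\<^sup>2"
        using L1[of "cis t"] by (intro power_mono) auto
      also have "\<dots> = (norm (poly p (cis t)))\<^sup>2 + (2 * norm (poly p (cis t)) * \<epsilon> + \<epsilon>\<^sup>2)"
        by (simp add: power2_sum)
      also have "2 * norm (poly p (cis t)) * \<epsilon> + \<epsilon>\<^sup>2 \<le> 2 * P * \<epsilon> + \<epsilon>\<^sup>2"
        using P(2)[of "cis t"] \<epsilon> by (intro add_right_mono mult_right_mono) auto
      finally show ?thesis using \<epsilon>_le by linarith
    qed
    have L_int: "integrable circ (\<lambda>t. Re (L (cis t)))"
      by (rule integrable_Re[OF integrable_circ_comp_cis[OF L_cont]])
    have A_le: "AE t in circ. norm (A t) \<le> 1"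
      using A_lim
    proof eventually_elim
      case (elim t)
      show ?case
        by (rule LIMSEQ_le_const2[OF tendsto_norm[OF elim]])
           (use bound norm_rad_cis rad_bounds in auto)
    qed
    have p_cont: "continuous_on S (\<lambda>t. poly p (cis t))" for S
      by (intro continuous_intros)
    have p_meas: "(\<lambda>t. poly p (cis t)) \<in> borel_measurable circ"
      by (rule borel_measurable_integrable) (intro integrable_circ_continuous p_cont)
    have pA_int: "integrable circ (\<lambda>t. (norm (poly p (cis t) * A t))\<^sup>2)"
    proof (rule circ.integrable_const_bound[where B = "P\<^sup>2"])
      show "AE t in circ. norm ((norm (poly p (cis t) * A t))\<^sup>2) \<le> P\<^sup>2"
        using A_le
      proof eventually_elim
        case (elim t)
        have "norm (poly p (cis t)) * norm (A t) \<le> P * 1"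
          using P(2)[of "cis t"] P(1) elim by (intro mult_mono) auto
        then show ?case by (auto simp: norm_mult intro!: power_mono)
      qed
      show "(\<lambda>t. (norm (poly p (cis t) * A t))\<^sup>2) \<in> borel_measurable circ"
        using p_meas A_meas by measurable
    qed
    \<comment> \<open>On each smaller circle the mean square of \<open>hfun d\<close> is at most
      \<open>(norm d)^2\<close>, and the functions are bounded by \<open>P\<close>; dominated
      convergence carries the bound to the boundary.\<close>
    have pA: "integral\<^sup>L circ (\<lambda>t. (norm (poly p (cis t) * A t))\<^sup>2) \<le> 2 * pi * (1 + \<eta>)\<^sup>2"
    proof -
      have "(\<lambda>k. integral\<^sup>L circ (\<lambda>t. (norm (hfun d (of_real (\<rho> k) * cis t)))\<^sup>2))
          \<longlonglongrightarrow> integral\<^sup>L circ (\<lambda>t. (norm (poly p (cis t) * A t))\<^sup>2)"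
      proof (rule integral_dominated_convergence[where w = "\<lambda>_. P\<^sup>2"])
        show "(\<lambda>t. (norm (hfun d (of_real (\<rho> k) * cis t)))\<^sup>2) \<in> borel_measurable circ" for k
          unfolding \<rho>_def
          by (rule borel_measurable_integrable)
             (intro integrable_circ_continuous continuous_intros continuous_on_hfun_rad)
        show "AE t in circ. (\<lambda>k. (norm (hfun d (of_real (\<rho> k) * cis t)))\<^sup>2)
            \<longlonglongrightarrow> (norm (poly p (cis t) * A t))\<^sup>2"
          using A_lim
        proof eventually_elim
          case (elim t)
          have "(\<lambda>k. (norm (poly p (of_real (\<rho> k) * cis t) * hfun x (of_real (\<rho> k) * cis t)))\<^sup>2)
              \<longlonglongrightarrow> (norm (poly p (of_real 1 * cis t) * A t))\<^sup>2"
            using elim by (intro tendsto_intros \<rho>_lim tendsto_compose[OF poly_isCont[unfolded isCont_def]])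
              (auto simp: \<rho>_def)
          moreover have "hfun d (of_real (\<rho> k) * cis t)
              = poly p (of_real (\<rho> k) * cis t) * hfun x (of_real (\<rho> k) * cis t)" for k
            by (rule p) (use \<rho>[of k] in \<open>simp add: norm_mult\<close>)
          ultimately show ?case by simp
        qed
        show "AE t in circ. norm ((norm (hfun d (of_real (\<rho> k) * cis t)))\<^sup>2) \<le> P\<^sup>2" for k
        proof (rule AE_I2)
          fix t
          have n: "norm (of_real (\<rho> k) * cis t) < 1" using \<rho>[of k] by (simp add: norm_mult)
          have "norm (poly p (of_real (\<rho> k) * cis t)) * norm (hfun x (of_real (\<rho> k) * cis t)) \<le> P * 1"
            using n by (intro mult_mono P(2) bound) (use P(1) in auto)
          then show "norm ((norm (hfun d (of_real (\<rho> k) * cis t)))\<^sup>2) \<le> P\<^sup>2"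
            using p[OF n] by (auto simp: norm_mult intro!: power_mono)
        qed
      qed (use pA_int in auto)
      moreover have "integral\<^sup>L circ (\<lambda>t. (norm (hfun d (of_real (\<rho> k) * cis t)))\<^sup>2) \<le> 2 * pi * (1 + \<eta>)\<^sup>2" for k
      proof -
        have "norm d \<le> 1 + \<eta>" using norm_triangle_ineq2[of d unit0] d by simp
        then have "2 * pi * (norm d)\<^sup>2 \<le> 2 * pi * (1 + \<eta>)\<^sup>2"
          by (intro mult_left_mono power_mono) auto
        then show ?thesis unfolding \<rho>_def using integral_hfun_rad_le[of d "\<sigma> k"] by linarith
      qed
      ultimately show ?thesis by (auto intro: LIMSEQ_le_const2)
    qed
    \<comment> \<open>\<open>M\<close> bounds the mean of the squared modulus of \<open>p A\<close>
      plus \<open>\<eta>\<close>. Integrating the tangent line inequality for \<open>ln\<close> at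
      \<open>M\<close> gives what Jensen's inequality would: the mean of the logarithm is at most
      \<open>ln M\<close>.\<close>
    define M where "M = (1 + \<eta>)\<^sup>2 + \<eta>"
    have M: "M > 0" using \<eta> by (simp add: M_def add_pos_pos)
    have "AE t in circ. 2 * Re (L (cis t)) - 2 * V t
        \<le> ((norm (poly p (cis t) * A t))\<^sup>2 + \<eta>) / M + (ln M - 1)"
      using A_nz A_le
    proof eventually_elim
      case (elim t)
      define X where "X = (exp (Re (L (cis t))))\<^sup>2 * (norm (A t))\<^sup>2"
      have X: "X > 0" using elim by (simp add: X_def)
      have "ln X = 2 * Re (L (cis t)) - 2 * V t"
        using elim by (simp add: X_def V_def ln_mult ln_realpow)
      moreover have "ln X - ln M \<le> X / M - 1"
        using ln_le_minus_one[of "X / M"] X M by (simp add: ln_div)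
      moreover have "X \<le> (norm (poly p (cis t) * A t))\<^sup>2 + \<eta>"
      proof -
        have "X \<le> ((norm (poly p (cis t)))\<^sup>2 + \<eta>) * (norm (A t))\<^sup>2"
          unfolding X_def by (intro mult_right_mono L_sq) auto
        also have "\<dots> = (norm (poly p (cis t) * A t))\<^sup>2 + \<eta> * (norm (A t))\<^sup>2"
          by (simp add: norm_mult power_mult_distrib algebra_simps)
        also have "\<eta> * (norm (A t))\<^sup>2 \<le> \<eta> * 1"
          using \<eta> elim by (intro mult_left_mono power_le_one) auto
        finally show ?thesis by simp
      qed
      then have "X / M \<le> ((norm (poly p (cis t) * A t))\<^sup>2 + \<eta>) / M"
        using M by (intro divide_right_mono) auto
      ultimately show ?case by linarith
    qed
    then have "integral\<^sup>L circ (\<lambda>t. 2 * Re (L (cis t)) - 2 * V t)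
        \<le> integral\<^sup>L circ (\<lambda>t. ((norm (poly p (cis t) * A t))\<^sup>2 + \<eta>) / M + (ln M - 1))"
      using L_int V_int pA_int by (intro integral_mono_AE) auto
    also have "\<dots> = (integral\<^sup>L circ (\<lambda>t. (norm (poly p (cis t) * A t))\<^sup>2) + 2 * pi * \<eta>) / M
        + 2 * pi * (ln M - 1)"
      using pA_int by simp
    also have "\<dots> \<le> (2 * pi * (1 + \<eta>)\<^sup>2 + 2 * pi * \<eta>) / M + 2 * pi * (ln M - 1)"
      using pA M by (intro add_right_mono divide_right_mono) auto
    also have "2 * pi * (1 + \<eta>)\<^sup>2 + 2 * pi * \<eta> = 2 * pi * M" by (simp add: M_def algebra_simps)
    also have "2 * pi * M / M + 2 * pi * (ln M - 1) = 2 * pi * ln M" using M by (simp add: algebra_simps)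
    also have "integral\<^sup>L circ (\<lambda>t. 2 * Re (L (cis t)) - 2 * V t)
        = 2 * pi * (2 * Re (L 0)) - 2 * integral\<^sup>L circ V"
      using L_int V_int mean_value_Re_circ[OF L_cont L_hol] by simp
    finally have "2 * pi * (2 * Re (L 0)) - 2 * integral\<^sup>L circ V \<le> 2 * pi * ln M" .
    then have "Re (L 0) \<le> integral\<^sup>L circ V / (2 * pi) + ln M / 2"
      by (simp add: field_simps)
    \<comment> \<open>At the origin \<open>hfun d\<close> is close to 1, so
      \<open>norm (poly p 0)\<close> is at least \<open>(1 - \<eta>) * exp C\<close>, and the
      majorant \<open>exp (Re (L 0))\<close> is no smaller.\<close>
    moreover have "1 - \<eta> \<le> exp (Re (L 0) - C)"
    proof -
      have "norm (poly p 0) * exp (- C) \<le> exp (Re (L 0)) * exp (- C)"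
        by (intro mult_right_mono L0) auto
      with p0 show ?thesis by (simp flip: exp_add)
    qed
    then have "ln (1 - \<eta>) \<le> Re (L 0) - C"
      using \<eta> ln_mono[of "1 - \<eta>" "exp (Re (L 0) - C)"] by simp
    ultimately show ?thesis by (simp add: M_def)
  qed
  \<comment> \<open>As \<open>\<eta>\<close> tends to 0, both logarithms in \<open>szego\<close>
    tend to 0.\<close>
  have "C \<le> integral\<^sup>L circ V / (2 * pi)"
  proof (rule tendsto_le[of "at_right 0"])
    have "((\<lambda>\<eta>::real. ln (1 - \<eta>) + C) \<longlongrightarrow> ln (1 - 0) + C) (at_right 0)"
      by (intro tendsto_intros) auto
    then show "((\<lambda>\<eta>::real. ln (1 - \<eta>) + C) \<longlongrightarrow> C) (at_right 0)" by simp
    have "((\<lambda>\<eta>::real. integral\<^sup>L circ V / (2 * pi) + ln ((1 + \<eta>)\<^sup>2 + \<eta>) / 2)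
        \<longlongrightarrow> integral\<^sup>L circ V / (2 * pi) + ln ((1 + 0)\<^sup>2 + 0) / 2) (at_right 0)"
      by (intro tendsto_intros) auto
    then show "((\<lambda>\<eta>::real. integral\<^sup>L circ V / (2 * pi) + ln ((1 + \<eta>)\<^sup>2 + \<eta>) / 2)
        \<longlongrightarrow> integral\<^sup>L circ V / (2 * pi)) (at_right 0)" by simp
    show "\<forall>\<^sub>F \<eta> in at_right 0. ln (1 - \<eta>) + C \<le> integral\<^sup>L circ V / (2 * pi) + ln ((1 + \<eta>)\<^sup>2 + \<eta>) / 2"
      using eventually_at_right_real[of 0 "1::real"] by (auto elim!: eventually_mono intro: szego)
  qed simp
  then have V_ge: "2 * pi * C \<le> integral\<^sup>L circ V" by (simp add: field_simps)

  \<comment> \<open>Scheffe's lemma: almost everywhere convergence, with integrals of the moduli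
    that do not exceed the integral of the limit, is convergence in \<open>L^1\<close>.\<close>
  have "(\<lambda>k. \<integral>\<^sup>+ t. norm (v k t - V t) \<partial>circ) \<longlonglongrightarrow> 0"
  proof (rule Scheffe_lemma1[OF v_int V_int v_lim])
    have "(\<integral>\<^sup>+ t. norm (V t) \<partial>circ) = (\<integral>\<^sup>+ t. V t \<partial>circ)"
      using V_nonneg by (intro nn_integral_cong_AE) auto
    also have "\<dots> = ennreal (integral\<^sup>L circ V)"
      by (rule nn_integral_eq_integral[OF V_int V_nonneg])
    finally have "ennreal (2 * pi * C) \<le> (\<integral>\<^sup>+ t. norm (V t) \<partial>circ)"
      using V_ge by (simp add: ennreal_leI)
    moreover have "(\<integral>\<^sup>+ t. norm (v k t) \<partial>circ) = ennreal (2 * pi * C)" for k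
      using v_nn[of k] v_nonneg by simp
    ultimately show "limsup (\<lambda>k. \<integral>\<^sup>+ t. norm (v k t) \<partial>circ) \<le> (\<integral>\<^sup>+ t. norm (V t) \<partial>circ)"
      by (simp add: Limsup_const)
  qed
  moreover have "(\<integral>\<^sup>+ t. norm (v k t - V t) \<partial>circ) = ennreal (LINT t|circ. norm (v k t - V t))" for k
    using v_int V_int by (intro nn_integral_eq_integral) auto
  ultimately have L1_lim: "(\<lambda>k. LINT t|circ. norm (v k t - V t)) \<longlonglongrightarrow> 0"
    by (simp add: tendsto_ennreal_iff[where x = 0, simplified])

  \<comment> \<open>The Schwarz formula for \<open>F k\<close> passes to the limit: the kernel is
    bounded for fixed \<open>z\<close>, \<open>v k\<close> converges in \<open>L^1\<close>, and
    \<open>F k z\<close> tends to \<open>g z\<close>.\<close>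
  have schwarz: "g z = \<i> * Im (g 0) + (1 / (2 * pi)) *
      integral\<^sup>L circ (\<lambda>t. (cis t + z) / (cis t - z) * of_real (- V t))" if z: "z \<in> disc" for z
  proof -
    have z1: "norm z < 1" using z by simp
    define H where "H = (\<lambda>t. (cis t + z) / (cis t - z))"
    have ne: "cis t \<noteq> z" for t using z1 by auto
    have H_cont: "continuous_on {0..2 * pi} H" unfolding H_def using ne by (intro continuous_intros) auto
    have H_meas: "H \<in> borel_measurable circ"
      by (rule borel_measurable_integrable) (rule integrable_circ_continuous[OF H_cont])
    have "bounded (H ` {0..2 * pi})"
      by (intro compact_imp_bounded compact_continuous_image H_cont) auto
    then obtain B where B: "B > 0" "\<And>t. t \<in> {0..2 * pi} \<Longrightarrow> norm (H t) \<le> B"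
      unfolding bounded_pos by auto
    have int: "integrable circ (\<lambda>t. H t * of_real (f t))" if "integrable circ f" for f :: "real \<Rightarrow> real"
    proof (rule Bochner_Integration.integrable_bound)
      show "integrable circ (\<lambda>t. B * f t)" using that by simp
      show "(\<lambda>t. H t * of_real (f t)) \<in> borel_measurable circ"
        using H_meas borel_measurable_integrable[OF that] by measurable
      show "AE t in circ. norm (H t * of_real (f t)) \<le> norm (B * f t)"
        using B by (intro AE_I2) (auto simp: norm_mult abs_mult intro!: mult_right_mono)
    qed
    have "(\<lambda>k. integral\<^sup>L circ (\<lambda>t. H t * of_real (- v k t)) - integral\<^sup>L circ (\<lambda>t. H t * of_real (- V t))) \<longlonglongrightarrow> 0"
    proof (rule Lim_null_comparison)
      show "(\<lambda>k. B * (LINT t|circ. norm (v k t - V t))) \<longlonglongrightarrow> 0"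
        using tendsto_mult_left[OF L1_lim, of B] by simp
      show "\<forall>\<^sub>F k in sequentially. norm (integral\<^sup>L circ (\<lambda>t. H t * of_real (- v k t))
          - integral\<^sup>L circ (\<lambda>t. H t * of_real (- V t))) \<le> B * (LINT t|circ. norm (v k t - V t))"
      proof (rule always_eventually, rule allI)
        fix k
        have "integral\<^sup>L circ (\<lambda>t. H t * of_real (- v k t)) - integral\<^sup>L circ (\<lambda>t. H t * of_real (- V t))
            = integral\<^sup>L circ (\<lambda>t. H t * of_real (- v k t) - H t * of_real (- V t))"
          by (rule Bochner_Integration.integral_diff[symmetric])
             (intro int integrable_minus v_int V_int)+
        also have "norm \<dots> \<le> (LINT t|circ. norm (H t * of_real (- v k t) - H t * of_real (- V t)))"
          by (rule integral_norm_bound)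
        also have "\<dots> \<le> (LINT t|circ. B * norm (v k t - V t))"
        proof (rule integral_mono)
          show "integrable circ (\<lambda>t. norm (H t * of_real (- v k t) - H t * of_real (- V t)))"
            by (intro integrable_norm Bochner_Integration.integrable_diff int integrable_minus v_int V_int)
          show "integrable circ (\<lambda>t. B * norm (v k t - V t))" using v_int V_int by auto
          fix t assume "t \<in> space circ"
          have "H t * of_real (- v k t) - H t * of_real (- V t) = H t * of_real (V t - v k t)"
            by (simp add: algebra_simps)
          then have "norm (H t * of_real (- v k t) - H t * of_real (- V t)) = norm (H t) * norm (v k t - V t)"
            by (simp only: norm_mult norm_of_real) (simp add: abs_minus_commute)
          also have "\<dots> \<le> B * norm (v k t - V t)"
            using B(2)[of t] \<open>t \<in> space circ\<close> by (intro mult_right_mono) auto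
          finally show "norm (H t * of_real (- v k t) - H t * of_real (- V t)) \<le> B * norm (v k t - V t)" .
        qed
        finally show "norm (integral\<^sup>L circ (\<lambda>t. H t * of_real (- v k t))
          - integral\<^sup>L circ (\<lambda>t. H t * of_real (- V t))) \<le> B * (LINT t|circ. norm (v k t - V t))" by simp
      qed
    qed
    then have "(\<lambda>k. integral\<^sup>L circ (\<lambda>t. H t * of_real (- v k t))) \<longlonglongrightarrow> integral\<^sup>L circ (\<lambda>t. H t * of_real (- V t))"
      by (rule LIM_zero_cancel)
    then have lim1: "(\<lambda>k. \<i> * Im (g 0) + (1 / (2 * pi)) * integral\<^sup>L circ (\<lambda>t. H t * of_real (- v k t)))
        \<longlonglongrightarrow> \<i> * Im (g 0) + (1 / (2 * pi)) * integral\<^sup>L circ (\<lambda>t. H t * of_real (- V t))"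
      by (intro tendsto_intros)
    have "F k z = \<i> * Im (g 0) + (1 / (2 * pi)) * integral\<^sup>L circ (\<lambda>t. H t * of_real (- v k t))" for k
      using Schwarz_integral_circ[OF F_cont F_hol z1, of k] by (simp add: H_def v_def) (simp add: F_def)
    moreover have "(\<lambda>k. F k z) \<longlonglongrightarrow> g z"
    proof -
      have "isCont g z"
        using continuous_on_interior[OF holomorphic_on_imp_continuous_on[OF g(1)], of z] z by simp
      moreover have "(\<lambda>k. of_real (\<rho> k) * z) \<longlonglongrightarrow> of_real 1 * z"
        by (intro tendsto_intros \<rho>_lim)
      ultimately show ?thesis unfolding F_def using isCont_tendsto_compose[of z g] by simp
    qed
    ultimately have "g z = \<i> * Im (g 0) + (1 / (2 * pi)) * integral\<^sup>L circ (\<lambda>t. H t * of_real (- V t))"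
      using lim1 by (intro LIMSEQ_unique[of "\<lambda>k. F k z"]) simp_all
    then show ?thesis by (simp add: H_def)
  qed
  show ?thesis
    unfolding outer_def
  \<comment> \<open>Exponentiating the formula for \<open>g\<close>: the imaginary part at the
    origin gives the unimodular constant, and \<open>- V\<close> is the logarithm of the boundary
    modulus.\<close>
  proof (intro exI[of _ "exp (\<i> * Im (g 0))"] exI[of _ "\<lambda>t. - V t"] conjI ballI)
    show "norm (exp (\<i> * Im (g 0))) = 1" by simp
    show "set_integrable lborel {0..2 * pi} (\<lambda>t. - V t)"
      using V_int unfolding integrable_circ_iff[symmetric] by simp
    fix z assume z: "z \<in> disc"
    show "hfun x z = exp (\<i> * Im (g 0)) * exp ((1 / (2 * pi)) *
         (LINT t:{0..2*pi}|lborel. ((exp (\<i> * t) + z) / (exp (\<i> * t) - z)) * complex_of_real (- V t)))"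
      unfolding g(2)[OF z] by (subst schwarz[OF z]) (simp only: exp_add integral_circ_eq cis_conv_exp)
  qed
qed

end

section \<open>Graphs of Sarason-Toeplitz operators\<close>

lemma hfun_tendsto:
  assumes "X \<longlonglongrightarrow> x"
  shows "(\<lambda>k. hfun (X k) z) \<longlonglongrightarrow> hfun x z"
proof (cases "norm z < 1")
  case True
  have "(\<lambda>k. hfun (X k - x) z) \<longlonglongrightarrow> 0"
  proof (rule Lim_null_comparison)
    have "(\<lambda>k. norm (X k - x)) \<longlonglongrightarrow> 0"
      using assms by (intro tendsto_norm_zero LIM_zero)
    then show "(\<lambda>k. norm (X k - x) / (1 - norm z)) \<longlonglongrightarrow> 0"
      using tendsto_divide[OF _ tendsto_const[of "1 - norm z"]] True by fastforce
  qed (auto intro!: always_eventually norm_hfun_le True)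
  then show ?thesis unfolding hfun_diff by (rule LIM_zero_cancel)
qed (simp add: hfun_outside)

text \<open>First components of elements of \<open>G\<close> are multiples of \<open>fst e\<close>,
  so approximating the constant 1 by them is cyclicity.\<close>

lemma (in shift_graph_generator) cyclic_multiplier_fst:
  assumes "\<And>\<epsilon>. \<epsilon> > 0 \<Longrightarrow> \<exists>g\<in>G. norm (fst g - unit0) < \<epsilon>"
  shows "cyclic_multiplier (fst e)"
proof
  show "norm (hfun (fst e) z) \<le> 1" if "norm z < 1" for z
    using multiplier_bound(1)[OF that] .
  show "\<exists>d. norm d \<le> norm c \<and> (\<forall>z. hfun d z = hfun c z * hfun (fst e) z)" for c
  proof -
    obtain g where g: "g \<in> G" "norm g = norm c"
      "\<And>z. hfun (fst g) z = hfun c z * hfun (fst e) z" "\<And>z. hfun (snd g) z = hfun c z * hfun (snd e) z"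
      using multiple_exists[of c] by blast
    have "norm (fst g) \<le> norm c" using norm_fst_le[of "fst g" "snd g"] g(2) by simp
    then show ?thesis using g(3) by blast
  qed
  show "\<exists>c d. norm (d - unit0) < \<epsilon> \<and> (\<forall>z. hfun d z = hfun c z * hfun (fst e) z)" if "\<epsilon> > 0" for \<epsilon>
    using assms[OF that] graph_eq_multiples by blast
qed

text \<open>If \<open>e = k e'\<close> for the generators of \<open>G\<close> and \<open>G'\<close>, then multiplication by \<open>k\<close> is isometric;
  since \<open>fst e\<close> is cyclic, \<open>k\<close> must attain its norm at the origin, so it is constant.\<close>

lemma dense_shift_graph_maximal:
  assumes "shift_graph G" "shift_graph G'" "G \<subseteq> G'"
    and dense: "\<And>\<epsilon>. \<epsilon> > 0 \<Longrightarrow> \<exists>g\<in>G. norm (fst g - unit0) < \<epsilon>"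
  shows "G' \<subseteq> G"
proof -
  interpret G: shift_graph G by fact
  interpret G': shift_graph G' by fact
  obtain e where e: "e \<in> G" "norm e = 1" "nth_ell2 (fst e) 0 \<noteq> 0"
    "\<And>g. g \<in> G \<Longrightarrow> inner e (rshift2 g) = 0" using G.unit_wandering_vector by blast
  obtain e' where e': "e' \<in> G'" "norm e' = 1" "nth_ell2 (fst e') 0 \<noteq> 0"
    "\<And>g. g \<in> G' \<Longrightarrow> inner e' (rshift2 g) = 0" using G'.unit_wandering_vector by blast
  interpret E: shift_graph_generator G e by unfold_locales (fact e)+
  interpret E': shift_graph_generator G' e' by unfold_locales (fact e')+
  interpret cyclic_multiplier "fst e" by (rule E.cyclic_multiplier_fst[OF dense])
  have "e \<in> G'" using e(1) assms(3) by blast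
  then obtain k where k: "norm k = 1" "\<And>z. hfun (fst e) z = hfun k z * hfun (fst e') z"
    "\<And>z. hfun (snd e) z = hfun k z * hfun (snd e') z"
    using E'.graph_eq_multiples[of e] e(2) by auto
  have nz: "hfun (fst e') z \<noteq> 0" if "norm z < 1" for z
    using nonzero[OF that] k(2)[of z] by auto
  \<comment> \<open>The multiple of \<open>e\<close> by \<open>c\<close> lies in \<open>G\<close>
    with norm \<open>norm c\<close>; as an element of \<open>G'\<close> it is the multiple of
    \<open>e'\<close> by \<open>c k\<close>, which therefore has the same norm.\<close>
  have isometric: "\<exists>d. norm d = norm c \<and> (\<forall>z. hfun d z = hfun c z * hfun k z)" for c
  proof -
    obtain g where g: "g \<in> G" "norm g = norm c"
      "\<And>z. hfun (fst g) z = hfun c z * hfun (fst e) z" "\<And>z. hfun (snd g) z = hfun c z * hfun (snd e) z"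
      using E.multiple_exists[of c] by blast
    then have "g \<in> G'" using assms(3) by blast
    then obtain d where d: "norm g = norm d" "\<And>z. hfun (fst g) z = hfun d z * hfun (fst e') z"
      using E'.graph_eq_multiples[of g] by blast
    have "hfun d z = hfun c z * hfun k z" for z
    proof (cases "norm z < 1")
      case True
      have "hfun d z * hfun (fst e') z = hfun c z * hfun k z * hfun (fst e') z"
        by (simp only: d(2)[of z, symmetric] g(3)[of z] k(2)[of z] mult.assoc)
      then show ?thesis using nz[OF True] by simp
    qed (simp add: hfun_outside)
    then show ?thesis using g(2) d(1) by metis
  qed
  \<comment> \<open>For \<open>g\<close>, the multiple of \<open>e\<close> by \<open>c\<close>, with
    first component near 1, let \<open>h\<close> be the multiple of \<open>e'\<close> by
    \<open>c\<close>. Then \<open>fst g\<close> is \<open>k\<close> times \<open>fst h\<close>, and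
    isometry bounds \<open>fst h\<close> by \<open>1 + \<epsilon>\<close>, so \<open>k\<close> at
    the origin cannot be much smaller than 1.\<close>
  have est: "1 - \<epsilon> \<le> (1 + \<epsilon>) * norm (nth_ell2 k 0)" if pos: "\<epsilon> > 0" for \<epsilon>
  proof -
    obtain g where g: "g \<in> G" "norm (fst g - unit0) < \<epsilon>" using dense[OF pos] by blast
    obtain c where c: "\<And>z. hfun (fst g) z = hfun c z * hfun (fst e) z"
      using E.graph_eq_multiples[of g] g(1) by blast
    obtain h where "h \<in> G'" "norm h = norm c" and h: "\<And>z. hfun (fst h) z = hfun c z * hfun (fst e') z"
      "\<And>z. hfun (snd h) z = hfun c z * hfun (snd e') z"
      using E'.multiple_exists[of c] by blast
    obtain d where d: "norm d = norm (fst h)" "\<And>z. hfun d z = hfun (fst h) z * hfun k z"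
      using isometric[of "fst h"] by blast
    have "hfun d = hfun (fst g)" by (simp add: fun_eq_iff d h c k mult_ac)
    then have dg: "d = fst g" by (simp add: hfun_inject)
    have "norm d \<le> 1 + \<epsilon>" using norm_triangle_ineq2[of "fst g" unit0] g(2) dg by simp
    then have h0: "norm (nth_ell2 (fst h) 0) \<le> 1 + \<epsilon>"
      using norm_nth_le[of "fst h" 0] d(1) by linarith
    have "norm (nth_ell2 d 0 - 1) \<le> \<epsilon>" using norm_nth_le[of "fst g - unit0" 0] g(2) dg by simp
    then have "1 - \<epsilon> \<le> norm (nth_ell2 d 0)"
      using norm_triangle_ineq2[of 1 "nth_ell2 d 0"] by (simp add: norm_minus_commute)
    also have "\<dots> = norm (nth_ell2 (fst h) 0) * norm (nth_ell2 k 0)"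
      using d(2)[of 0] by (simp add: norm_mult)
    also have "\<dots> \<le> (1 + \<epsilon>) * norm (nth_ell2 k 0)" using h0 by (intro mult_right_mono) auto
    finally show ?thesis .
  qed
  have "1 \<le> norm (nth_ell2 k 0)"
  proof (rule tendsto_le[of "at_right 0"])
    have "((\<lambda>\<epsilon>::real. 1 - \<epsilon>) \<longlongrightarrow> 1 - 0) (at_right 0)" by (intro tendsto_intros)
    then show "((\<lambda>\<epsilon>::real. 1 - \<epsilon>) \<longlongrightarrow> 1) (at_right 0)" by simp
    have "((\<lambda>\<epsilon>::real. (1 + \<epsilon>) * norm (nth_ell2 k 0)) \<longlongrightarrow> (1 + 0) * norm (nth_ell2 k 0)) (at_right 0)"
      by (intro tendsto_intros)
    then show "((\<lambda>\<epsilon>::real. (1 + \<epsilon>) * norm (nth_ell2 k 0)) \<longlongrightarrow> norm (nth_ell2 k 0)) (at_right 0)" by simp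
    show "\<forall>\<^sub>F \<epsilon> in at_right 0. 1 - \<epsilon> \<le> (1 + \<epsilon>) * norm (nth_ell2 k 0)"
      using eventually_at_right_less[of "0::real"] by eventually_elim (rule est)
  qed simp
  then have k0: "norm (nth_ell2 k 0) = 1" using norm_nth_le[of k 0] k(1) by simp
  \<comment> \<open>A unit vector whose constant coefficient has modulus 1 has no other nonzero
    coefficient.\<close>
  have "k = cscale (nth_ell2 k 0) unit0"
  proof (rule ell2_eqI)
    fix n
    have "nth_ell2 k n = 0" if "n \<noteq> 0"
    proof -
      have "(\<Sum>m\<in>{0, n}. (norm (nth_ell2 k m))\<^sup>2) \<le> (norm k)\<^sup>2"
        unfolding norm_ell2_sq by (rule sum_le_suminf[OF summable_nth_sq]) auto
      then show ?thesis using that k0 k(1) by simp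
    qed
    then show "nth_ell2 k n = nth_ell2 (cscale (nth_ell2 k 0) unit0) n" by simp
  qed
  then have kz: "hfun k z = nth_ell2 k 0" if "norm z < 1" for z
    using hfun_cscale[of "nth_ell2 k 0" unit0 z] hfun_unit0[OF that] by simp
  show ?thesis
  proof
    fix g assume "g \<in> G'"
    then obtain c where c: "norm g = norm c" "\<And>z. hfun (fst g) z = hfun c z * hfun (fst e') z"
      "\<And>z. hfun (snd g) z = hfun c z * hfun (snd e') z"
      using E'.graph_eq_multiples by blast
    define c' where "c' = cscale (1 / nth_ell2 k 0) c"
    have "nth_ell2 k 0 \<noteq> 0" using k0 by auto
    then have c': "hfun c' z * hfun k z = hfun c z" for z
      using kz[of z] by (cases "norm z < 1") (auto simp: c'_def hfun_cscale hfun_outside)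
    have "norm g = norm c'" using c(1) k0 by (simp add: c'_def norm_divide)
    moreover have "hfun (fst g) z = hfun c' z * hfun (fst e) z"
      "hfun (snd g) z = hfun c' z * hfun (snd e) z" for z
      using c'[of z] by (simp_all add: c k flip: mult.assoc)
    ultimately show "g \<in> G" unfolding E.graph_eq_multiples by blast
  qed
qed

text \<open>Evaluation at points is continuous, so the multiplication relation survives limits.
  After division by \<open>z\<close> it holds away from the origin, and at the origin by
  continuity.\<close>

lemma shift_graph_mult_op:
  assumes \<phi>: "\<phi> holomorphic_on disc"
    and nontrivial: "\<exists>x. hfun x 0 \<noteq> 0 \<and> mult_op \<phi> (hfun x) \<in> H2"
  shows "shift_graph {g. hfun (snd g) = mult_op \<phi> (hfun (fst g))}" (is "shift_graph ?G")
proof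
  have "mult_op \<phi> (hfun x) z = \<phi> z * hfun x z" for x z
    unfolding mult_op_def using hfun_outside[of z x] by auto
  then have iff: "g \<in> ?G \<longleftrightarrow> (\<forall>z. hfun (snd g) z = \<phi> z * hfun (fst g) z)" for g
    by (simp add: fun_eq_iff)
  show "closed ?G"
  proof (unfold closed_sequential_limits, intro allI impI, elim conjE)
    fix X g assume X: "\<forall>n. X n \<in> ?G" and lim: "X \<longlonglongrightarrow> g"
    have "hfun (snd g) z = \<phi> z * hfun (fst g) z" for z
    proof (rule LIMSEQ_unique)
      show "(\<lambda>n. hfun (snd (X n)) z) \<longlonglongrightarrow> hfun (snd g) z"
        by (intro hfun_tendsto tendsto_snd lim)
      have "(\<lambda>n. \<phi> z * hfun (fst (X n)) z) \<longlonglongrightarrow> \<phi> z * hfun (fst g) z"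
        by (intro tendsto_mult_left hfun_tendsto tendsto_fst lim)
      then show "(\<lambda>n. hfun (snd (X n)) z) \<longlonglongrightarrow> \<phi> z * hfun (fst g) z"
        using X unfolding iff by simp
    qed
    then show "g \<in> ?G" unfolding iff by blast
  qed
  show "g + h \<in> ?G" if "g \<in> ?G" "h \<in> ?G" for g h
    using that unfolding iff by (simp add: hfun_add algebra_simps)
  show "cscale2 c g \<in> ?G" if "g \<in> ?G" for c g
    using that unfolding iff by (simp add: hfun_cscale)
  show "rshift2 g \<in> ?G" if "g \<in> ?G" for g
    using that unfolding iff by (simp add: hfun_rshift)
  show "nth_ell2 (snd g) 0 = 0 \<and> lshift2 g \<in> ?G" if "g \<in> ?G" "nth_ell2 (fst g) 0 = 0" for g
  proof
    have g: "hfun (snd g) z = \<phi> z * hfun (fst g) z" for z using that(1) unfolding iff by blast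
    show s0: "nth_ell2 (snd g) 0 = 0" using g[of 0] that(2) by simp
    define w where "w = (\<lambda>z. hfun (lshift (snd g)) z - \<phi> z * hfun (lshift (fst g)) z)"
    have wz: "w z = 0" if "z \<noteq> 0" for z
    proof -
      have "z * hfun (lshift (snd g)) z = z * (\<phi> z * hfun (lshift (fst g)) z)"
        using g[of z] hfun_rshift[of "lshift (snd g)" z] hfun_rshift[of "lshift (fst g)" z]
        unfolding rshift_lshift[OF s0] rshift_lshift[OF \<open>nth_ell2 (fst g) 0 = 0\<close>]
        by (metis mult.left_commute)
      then show ?thesis using that by (simp add: w_def)
    qed
    have "w 0 = 0"
    proof (rule LIM_unique)
      have "continuous_on disc w"
        unfolding w_def by (intro holomorphic_on_imp_continuous_on holomorphic_intros hfun_holomorphic \<phi>)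
      then have "isCont w 0" using continuous_on_interior[of disc w 0] by simp
      then show "w \<midarrow>0\<rightarrow> w 0" by (simp add: isCont_def)
      show "w \<midarrow>0\<rightarrow> 0"
        by (rule tendsto_eventually) (auto simp: eventually_at_filter wz)
    qed
    then have "w z = 0" for z using wz by (cases "z = 0") auto
    then show "lshift2 g \<in> ?G" unfolding iff by (simp add: w_def)
  qed
  obtain x y where "hfun x 0 \<noteq> 0" "mult_op \<phi> (hfun x) = hfun y"
    using nontrivial unfolding H2_eq_range by blast
  then show "\<exists>g\<in>?G. nth_ell2 (fst g) 0 \<noteq> 0" by (intro bexI[of _ "(x, y)"]) auto
qed

text \<open>The graph is taken in coefficient space, where completeness and the inner product are
  available.\<close>

definition op_graph where
  "op_graph D T = {g. hfun (fst g) \<in> D \<and> T (hfun (fst g)) = hfun (snd g)}"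

lemma dense_op_graph:
  assumes "linear_op D T" "densely_defined D" "\<epsilon> > 0"
  shows "\<exists>g\<in>op_graph D T. norm (fst g - unit0) < \<epsilon>"
proof -
  obtain f where f: "f \<in> D" "h2_norm (\<lambda>z. hfun unit0 z - f z) < \<epsilon>"
    using assms hfun_in_H2 unfolding densely_defined_def by blast
  have "f \<in> H2" "T f \<in> H2" using f(1) assms(1) unfolding linear_op_def by auto
  then obtain x y where "f = hfun x" "T f = hfun y" unfolding H2_eq_range by blast
  then show ?thesis
    using f by (intro bexI[of _ "(x, y)"]) (auto simp: op_graph_def h2_norm_hfun_diff norm_minus_commute)
qed

text \<open>The vanishing condition supplies the one coefficient that \<open>bshift\<close> forgets,
  so the Toeplitz relation becomes commutation of \<open>T\<close> with the shift, recorded as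
  \<open>T_rshift\<close>. Density prevents all first components from vanishing at the
  origin.\<close>

lemma shift_graph_op_graph:
  assumes st: "sarason_toeplitz D T" and T0: "\<forall>f\<in>D. T (shift f) 0 = 0"
  shows "shift_graph (op_graph D T)"
proof
  have lin: "linear_op D T" and clo: "closed_op D T" and dense: "densely_defined D"
    and sh: "\<And>f. f \<in> D \<Longrightarrow> shift f \<in> D" and toeplitz: "\<And>f. f \<in> D \<Longrightarrow> bshift (T (shift f)) = T f"
    and bsh: "\<And>f. f \<in> D \<Longrightarrow> f 0 = 0 \<Longrightarrow> bshift f \<in> D"
    using st by (auto simp: sarason_toeplitz_def)
  have H2: "f \<in> D \<Longrightarrow> f \<in> H2" "f \<in> D \<Longrightarrow> T f \<in> H2" for f
    using lin by (auto simp: linear_op_def)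
  have comb: "(\<lambda>z. a * f z + b * g z) \<in> D" "T (\<lambda>z. a * f z + b * g z) = (\<lambda>z. a * T f z + b * T g z)"
    if "f \<in> D" "g \<in> D" for f g a b using lin that by (auto simp: linear_op_def)
  show "closed (op_graph D T)"
  proof (unfold closed_sequential_limits, intro allI impI, elim conjE)
    fix X g assume X: "\<forall>n. X n \<in> op_graph D T" and lim: "X \<longlonglongrightarrow> g"
    have "(\<lambda>k. h2_norm (\<lambda>z. hfun (fst (X k)) z - hfun (fst g) z)) \<longlonglongrightarrow> 0"
      unfolding h2_norm_hfun_diff by (intro tendsto_norm_zero LIM_zero tendsto_fst lim)
    moreover have "(\<lambda>k. h2_norm (\<lambda>z. T (hfun (fst (X k))) z - hfun (snd g) z)) \<longlonglongrightarrow> 0"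
    proof -
      have "(\<lambda>k. h2_norm (\<lambda>z. hfun (snd (X k)) z - hfun (snd g) z)) \<longlonglongrightarrow> 0"
        unfolding h2_norm_hfun_diff by (intro tendsto_norm_zero LIM_zero tendsto_snd lim)
      then show ?thesis using X by (simp add: op_graph_def)
    qed
    ultimately show "g \<in> op_graph D T"
      using clo[unfolded closed_op_def, rule_format, of "\<lambda>k. hfun (fst (X k))" "hfun (fst g)" "hfun (snd g)"]
        X hfun_in_H2 by (simp add: op_graph_def)
  qed
  show "g + h \<in> op_graph D T" if "g \<in> op_graph D T" "h \<in> op_graph D T" for g h
  proof -
    have "hfun (fst (g + h)) = (\<lambda>z. 1 * hfun (fst g) z + 1 * hfun (fst h) z)"
      "hfun (snd (g + h)) = (\<lambda>z. 1 * hfun (snd g) z + 1 * hfun (snd h) z)"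
      by (simp_all add: fun_eq_iff hfun_add)
    then show ?thesis using that comb[of "hfun (fst g)" "hfun (fst h)" 1 1] by (simp add: op_graph_def)
  qed
  show "cscale2 c g \<in> op_graph D T" if "g \<in> op_graph D T" for c g
  proof -
    have "hfun (fst (cscale2 c g)) = (\<lambda>z. c * hfun (fst g) z + 0 * hfun (fst g) z)"
      "hfun (snd (cscale2 c g)) = (\<lambda>z. c * hfun (snd g) z + 0 * hfun (snd g) z)"
      by (simp_all add: fun_eq_iff hfun_cscale)
    then show ?thesis using that comb[of "hfun (fst g)" "hfun (fst g)" c 0] by (simp add: op_graph_def)
  qed
  have T_rshift: "T (hfun (rshift x)) = hfun (rshift y)" if x: "hfun x \<in> D" "T (hfun x) = hfun y" for x y
  proof -
    have "T (hfun (rshift x)) \<in> H2" using sh[OF x(1)] H2(2) by (simp add: shift_hfun)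
    then obtain w where w: "T (hfun (rshift x)) = hfun w" unfolding H2_eq_range by blast
    have "hfun (lshift w) = hfun y" using toeplitz[OF x(1)] x(2) by (simp add: shift_hfun w bshift_hfun)
    moreover have "nth_ell2 w 0 = 0" using T0 x(1) w by (metis hfun_at_0 shift_hfun)
    ultimately have "w = rshift y" using rshift_lshift[of w] by (simp add: hfun_inject)
    then show ?thesis using w by simp
  qed
  show "rshift2 g \<in> op_graph D T" if "g \<in> op_graph D T" for g
    using that T_rshift[of "fst g" "snd g"] sh[of "hfun (fst g)"] by (simp add: op_graph_def shift_hfun)
  \<comment> \<open>A function in the domain that vanishes at the origin is the shift of its
    backward shift, which is again in the domain, so \<open>T_rshift\<close> applies to the
    latter.\<close>
  show "nth_ell2 (snd g) 0 = 0 \<and> lshift2 g \<in> op_graph D T"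
    if g: "g \<in> op_graph D T" "nth_ell2 (fst g) 0 = 0" for g
  proof -
    have D: "hfun (lshift (fst g)) \<in> D"
      using bsh[of "hfun (fst g)"] g by (simp add: op_graph_def bshift_hfun)
    then obtain y where y: "T (hfun (lshift (fst g))) = hfun y" using H2(2) unfolding H2_eq_range by blast
    have "hfun (snd g) = hfun (rshift y)"
      using T_rshift[OF D y] g by (simp add: rshift_lshift op_graph_def)
    then have "snd g = rshift y" by (simp add: hfun_inject)
    moreover have "lshift (rshift y) = y" by (rule ell2_eqI) simp
    ultimately show ?thesis using D y by (simp add: op_graph_def)
  qed
  obtain g where g: "g \<in> op_graph D T" "norm (fst g - unit0) < 1"
    using dense_op_graph[OF lin dense zero_less_one] by blast
  then have "nth_ell2 (fst g) 0 \<noteq> 0" using norm_nth_le[of "fst g - unit0" 0] by auto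
  then show "\<exists>g\<in>op_graph D T. nth_ell2 (fst g) 0 \<noteq> 0" using g(1) by blast
qed

text \<open>The symbol is the quotient of the two components of a generator: both are bounded by
  \<open>multiplier_bound\<close>, and the denominator is outer by \<open>outer_hfun\<close>.
  Equality of the domains, beyond inclusion, comes from
  \<open>dense_shift_graph_maximal\<close>.\<close>

lemma smirnov_symbol_exists:
  assumes st: "sarason_toeplitz D T" and T0: "\<forall>f\<in>D. T (shift f) 0 = 0"
  shows "\<exists>\<phi>\<in>smirnov. D = mult_dom \<phi> \<and> (\<forall>f\<in>D. T f = mult_op \<phi> f)"
proof -
  have lin: "linear_op D T" and densely: "densely_defined D"
    using st by (auto simp: sarason_toeplitz_def)
  have H2: "f \<in> D \<Longrightarrow> f \<in> H2" "f \<in> D \<Longrightarrow> T f \<in> H2" for f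
    using lin by (auto simp: linear_op_def)
  define G where "G = op_graph D T"
  have dense: "\<exists>g\<in>G. norm (fst g - unit0) < \<epsilon>" if "\<epsilon> > 0" for \<epsilon>
    unfolding G_def by (rule dense_op_graph[OF lin densely that])
  interpret G: shift_graph G unfolding G_def by (rule shift_graph_op_graph[OF st T0])
  obtain e where e: "e \<in> G" "norm e = 1" "nth_ell2 (fst e) 0 \<noteq> 0"
    "\<And>g. g \<in> G \<Longrightarrow> inner e (rshift2 g) = 0" using G.unit_wandering_vector by blast
  interpret E: shift_graph_generator G e by unfold_locales (fact e)+
  interpret cyclic_multiplier "fst e" by (rule E.cyclic_multiplier_fst[OF dense])
  define \<phi> where "\<phi> = (\<lambda>z. hfun (snd e) z / hfun (fst e) z)"
  have "hfun (fst e) \<in> Hinf" "hfun (snd e) \<in> Hinf"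
    using E.multiplier_bound by (auto simp: Hinf_def hfun_holomorphic bounded_iff intro!: exI[of _ 1])
  then have "\<phi> \<in> smirnov"
    unfolding smirnov_def \<phi>_def using outer_hfun by blast
  have \<phi>_hol: "\<phi> holomorphic_on disc"
    unfolding \<phi>_def using nonzero by (intro holomorphic_intros hfun_holomorphic) auto
  define G' where "G' = {g. hfun (snd g) = mult_op \<phi> (hfun (fst g))}"
  have sub: "G \<subseteq> G'"
  proof
    fix g assume "g \<in> G"
    then obtain c where c: "\<And>z. hfun (fst g) z = hfun c z * hfun (fst e) z"
      "\<And>z. hfun (snd g) z = hfun c z * hfun (snd e) z"
      using E.graph_eq_multiples by blast
    have "hfun (snd g) z = mult_op \<phi> (hfun (fst g)) z" for z
      using nonzero[of z] by (auto simp: mult_op_def \<phi>_def c(1) c(2) hfun_outside)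
    then show "g \<in> G'" by (auto simp: G'_def)
  qed
  have "shift_graph G'"
    unfolding G'_def
  proof (rule shift_graph_mult_op[OF \<phi>_hol])
    have "hfun (snd e) = mult_op \<phi> (hfun (fst e))" using e(1) sub by (auto simp: G'_def)
    then show "\<exists>x. hfun x 0 \<noteq> 0 \<and> mult_op \<phi> (hfun x) \<in> H2"
      using e(3) hfun_in_H2[of "snd e"] by (intro exI[of _ "fst e"]) simp
  qed
  then have eq: "G' \<subseteq> G"
    using dense_shift_graph_maximal[OF G.shift_graph_axioms _ sub dense] by blast
  have T_eq: "T f = mult_op \<phi> f" if f: "f \<in> D" for f
  proof -
    obtain x y where xy: "f = hfun x" "T f = hfun y" using H2[OF f] unfolding H2_eq_range by blast
    then have "(x, y) \<in> G" using f by (simp add: G_def op_graph_def)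
    then show ?thesis using sub xy by (auto simp: G'_def)
  qed
  have "D = mult_dom \<phi>"
  proof
    show "D \<subseteq> mult_dom \<phi>" using H2 T_eq by (force simp: mult_dom_def)
    show "mult_dom \<phi> \<subseteq> D"
    proof
      fix f assume "f \<in> mult_dom \<phi>"
      then obtain x y where xy: "f = hfun x" "mult_op \<phi> f = hfun y"
        unfolding mult_dom_def H2_eq_range by blast
      then have "(x, y) \<in> G" using eq by (auto simp: G'_def)
      then show "f \<in> D" using xy by (simp add: G_def op_graph_def)
    qed
  qed
  with T_eq \<open>\<phi> \<in> smirnov\<close> show ?thesis by blast
qed

text \<open>Every negative Fourier coefficient vanishes, being the value at 0 of \<open>T\<close> on
  the shift of an iterated shift of \<open>f\<close>, which stays in the domain. Only the analytic
  part of the series remains.\<close>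

lemma hf_eq_op:
  assumes st: "sarason_toeplitz D T" and T0: "\<forall>f\<in>D. T (shift f) 0 = 0"
    and f: "f \<in> D" and z: "z \<in> disc"
  shows "hf T f z = T f z"
proof -
  have "T f \<in> H2" using st f by (auto simp: sarason_toeplitz_def linear_op_def)
  then obtain y where y: "T f = hfun y" unfolding H2_eq_range by blast
  have "(shift ^^ n) f \<in> D" for n
    using st f by (induction n) (auto simp: sarason_toeplitz_def)
  then have "hf_coeff T f (- int (Suc n)) = 0" for n
    using T0 by (simp add: hf_coeff_def nat_add_distrib)
  moreover have "hf_coeff T f (int n) = nth_ell2 y n" for n
    by (simp add: hf_coeff_def y)
  ultimately show ?thesis using z by (simp add: hf_def y hfun_def del: of_nat_Suc)
qed

theorem theorem1:
  fixes D :: "(complex \<Rightarrow> complex) set"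
    and T :: "(complex \<Rightarrow> complex) \<Rightarrow> (complex \<Rightarrow> complex)"
  assumes "sarason_toeplitz D T"
  shows "((\<exists>\<phi>\<in>smirnov. D = mult_dom \<phi> \<and> (\<forall>f\<in>D. T f = mult_op \<phi> f))
            \<longleftrightarrow> (\<forall>f\<in>D. T (shift f) 0 = 0))
         \<and> ((\<forall>f\<in>D. T (shift f) 0 = 0) \<longrightarrow>
             (\<forall>f1\<in>D. \<forall>f2\<in>D. f1 \<noteq> (\<lambda>z. 0) \<longrightarrow> f2 \<noteq> (\<lambda>z. 0) \<longrightarrow> same_sub_symbol T f1 f2))"
proof (intro conjI iffI impI)
  assume "\<exists>\<phi>\<in>smirnov. D = mult_dom \<phi> \<and> (\<forall>f\<in>D. T f = mult_op \<phi> f)"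
  then obtain \<phi> where "\<forall>f\<in>D. T f = mult_op \<phi> f" by blast
  \<comment> \<open>A shifted function vanishes at the origin, hence so does its product with the
    symbol.\<close>
  then show "\<forall>f\<in>D. T (shift f) 0 = 0"
    using assms by (auto simp: sarason_toeplitz_def mult_op_def shift_def)
next
  assume T0: "\<forall>f\<in>D. T (shift f) 0 = 0"
  from smirnov_symbol_exists[OF assms T0]
  show "\<exists>\<phi>\<in>smirnov. D = mult_dom \<phi> \<and> (\<forall>f\<in>D. T f = mult_op \<phi> f)" .
  then obtain \<phi> where "\<forall>f\<in>D. T f = mult_op \<phi> f" by blast
  \<comment> \<open>Away from the zeros of \<open>f\<close> the sub-symbol is \<open>\<phi>\<close>,
    which does not depend on \<open>f\<close>.\<close>
  then have "sub_symbol T f z = \<phi> z" if "f \<in> D" "z \<in> disc" "f z \<noteq> 0" for f z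
    using that hf_eq_op[OF assms T0 that(1,2)] by (simp add: sub_symbol_def mult_op_def)
  then show "\<forall>f1\<in>D. \<forall>f2\<in>D. f1 \<noteq> (\<lambda>z. 0) \<longrightarrow> f2 \<noteq> (\<lambda>z. 0) \<longrightarrow> same_sub_symbol T f1 f2"
    by (simp add: same_sub_symbol_def)
qed

end
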